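(* The set $$\widehat{\mathcal G}=\{A(i;b,j)\mid i\in[1,p],\ j\in[0,p-b-1]\}\cup\{B(i,j)\mid i,j\in[1,p-1]\}\cup\{L(l;i,j)\mid l,i,j\in[1,p-1],\ i\le j,\ l<j\}$$ is a minimal Gröbner basis, with respect to the monomial order $>_{\mathcal M}$, for the first syzygy module $\mathcal N$ of the ideal $\wp$.
   Context: Setting. $\mathbb N$ is the set of non-negative integers and $[a,b]=\{i\in\mathbb{Z}\mid a\le i\le b\}$. Let $p\ge 2$, $d\ge1$, and let $0<m_0<m_1<\dots<m_p$ be integers with $m_i=m_0+id$ for $i\in[1,p]$, $m_0=ap+b$ with $a\ge1$ and $b\in[1,p]$, $\gcd(m_0,d)=1$, and assume $\{m_0,\dots,m_p\}$ is a minimal set of generators of the numerical semigroup $\Gamma=\sum_{i=0}^p\mathbb N m_i$. Let $K$ be a field, $R=K[X_1,\dots,X_p,X_0]$, and let $\wp$ be the kernel of the $K$-algebra homomorphism $\eta:R\to K[T]$, $\eta(X_i)=T^{m_i}$ for $i\in[0,p]$. Put $\epsilon(i,j)=i+j$ if $i+j<p$ and $\epsilon(i,j)=p$ if $i+j\ge p$; $\tau(i,j)=0$ if $i+j<p$ and $\tau(i,j)=p$ if $i+j\ge p$. Let $\phi(i,j)=X_iX_j-X_{\epsilon(i,j)}X_{i+j-\epsilon(i,j)}$ for $i,j\in[1,p-1]$ and $\psi(b,i)=X_{b+i}X_p^a-X_iX_0^{a+d}$ for $i\in[0,p-b]$. The set $\{\phi(i,j)\mid i,j\in[1,p-1]\}\cup\{\psi(b,i)\mid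 i\in[0,p-b]\}$ is a minimal generating set of $\wp$. Note $\phi(i,j)=\phi(j,i)$. Order on $R$. The weight of a monomial is given by $\omega(X_i)=m_i$ and $\omega(fg)=\omega(f)+\omega(g)$. For monomials $f=\prod_{i=1}^pX_i^{\alpha_i}X_0^{\alpha_0}$ and $g=\prod_{i=1}^pX_i^{\alpha_i'}X_0^{\alpha_0'}$, $f>_R g$ iff either $\omega(f)>\omega(g)$, or $\omega(f)=\omega(g)$ and the right-most non-zero entry of $(\alpha_1-\alpha_1',\dots,\alpha_p-\alpha_p',\alpha_0-\alpha_0')$ is negative. Syzygy module. Let $\mathcal M$ be the free $R$-module with basis the symbols $\Psi(b,i)$, $i\in[0,p-b]$, and $\Phi(i,j)$, $1\le i\le j\le p-1$. Let $\varphi$ be the $R$-linear map from $\mathcal M$ to $R$ with $\varphi(\Psi(b,i))=\psi(b,i)$ and $\varphi(\Phi(i,j))=\phi(i,j)$ (in the paper the values are multiplied by an auxiliary variable $t$, which does not affect the kernel). The first syzygy module of $\wp$ is $\mathcal N=\ker\varphi\subseteq\mathcal M$. (The symmetric algebra of $\wp$ is the quotient of $R[\Psi(b,i),\Phi(i,j)]$ by the ideal generated by $\mathcal N$, viewed as a set of linear forms.) Order on $\mathcal M$. Monomials of $\mathcal M$ are $\mathbb X^\alpha\mathbf e$ with $\mathbb X^\alpha$ a monomial of $R$ and $\mathbf e$ a basis symbol. Put $\varpi(\mathbb X^\alpha\Psi(b,i))=\mathbb X^\alpha X_p^aX_{b+i}$ and $\varpi(\mathbb X^\alpha\Phi(i,j))=\mathbb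 X^\alpha X_iX_j$. Then $\mathbb X^\alpha\mathbf e>_{\mathcal M}\mathbb X^{\alpha'}\mathbf e'$ iff either $\varpi(\mathbb X^\alpha\mathbf e)>_R\varpi(\mathbb X^{\alpha'}\mathbf e')$, or these are equal and one of the following holds: (i) $\mathbf e=\Psi(b,i)$, $\mathbf e'=\Psi(b,j)$ and $i<j$; (ii) $\mathbf e=\Psi(b,i)$ and $\mathbf e'=\Phi(l,j)$; (iii) $\mathbf e=\Phi(i,j)$, $\mathbf e'=\Phi(i',j')$ (with $i\le j$, $i'\le j'$) and either $j>j'$, or $j=j'$ and $i>i'$. The elements. In the following formulas set $\Phi(i,j)=\Phi(j,i)$, and $\Phi(i,j)=0$ unless both $i,j\in[1,p-1]$. $$A(i;b,j)=X_i\Psi(b,j)-X_{b+i+j-\epsilon(i,b+j)}\Psi(b,\epsilon(i,b+j)-b)-X_p^a\Phi(i,b+j)+X_0^{a+d}\big[\Phi(i,j)-\Phi(b+i+j-p,\,p-b)\big],$$ $$B(i,j)=X_iX_j\Psi(b,p-b)-X_{\epsilon(i,j)}X_{i+j-\epsilon(i,j)}\Psi(b,p-b)-\psi(b,p-b)\Phi(i,j),$$ $$L(l;i,j)=X_l\Phi(i,j)-X_j\Phi(i,l)+X_{\tau(i,j)}\Phi(i+j-\tau(i,j),\,l)-X_{\tau(i,l)}\Phi(i+l-\tau(i,l),\,j).$$ The leading terms with respect to $>_{\mathcal M}$ are the first terms written: $X_i\Psi(b,j)$, $X_iX_j\Psi(b,p-b)$, $X_l\Phi(i,j)$ respectively.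 A finite subset $G$ of $\mathcal N$ is a Gröbner basis of $\mathcal N$ if the leading terms of its elements generate the submodule generated by the leading terms of all nonzero elements of $\mathcal N$; it is minimal if moreover all leading coefficients are $1$ and the leading monomial of no element of $G$ divides that of another distinct element of $G$. *)

theory Defs
  imports "HOL-Library.Poly_Mapping"
begin

section \<open>Numerical semigroups\<close>

definition semigroup_gen :: "nat set \<Rightarrow> nat set" where
  "semigroup_gen S = {\<Sum>s\<in>F. c s * s | F c. finite F \<and> F \<subseteq> S}"

definition minimal_generators :: "nat set \<Rightarrow> bool" where
  "minimal_generators S \<longleftrightarrow> (\<forall>T. T \<subset> S \<longrightarrow> semigroup_gen T \<noteq> semigroup_gen S)"

section \<open>The polynomial ring and the monomial order on it\<close>

type_synonym mono = "nat \<Rightarrow>\<^sub>0 nat"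
type_synonym 'k mpoly = "mono \<Rightarrow>\<^sub>0 'k"

text \<open>The type \<open>'k mpoly\<close> has the variables \<open>X\<^sub>i\<close> for all natural \<open>i\<close>; the ring
  \<open>R = K[X\<^sub>1, \<dots>, X\<^sub>p, X\<^sub>0]\<close> is the following subring.\<close>

definition polys :: "nat \<Rightarrow> 'k::field mpoly set" where
  "polys p = {f. \<forall>t\<in>Poly_Mapping.keys f. Poly_Mapping.keys t \<subseteq> {0..p}}"

definition X :: "nat \<Rightarrow> 'k::field mpoly" where
  "X i = Poly_Mapping.single (Poly_Mapping.single i 1) 1"

definition weight :: "nat \<Rightarrow> (nat \<Rightarrow> nat) \<Rightarrow> mono \<Rightarrow> nat" where
  "weight p m t = (\<Sum>i=0..p. Poly_Mapping.lookup t i * m i)"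

text \<open>The entries \<open>(\<alpha>\<^sub>1 - \<alpha>'\<^sub>1, \<dots>, \<alpha>\<^sub>p - \<alpha>'\<^sub>p, \<alpha>\<^sub>0 - \<alpha>'\<^sub>0)\<close>: the variable \<open>X\<^sub>0\<close> comes last.\<close>

definition exp_diff :: "nat \<Rightarrow> mono \<Rightarrow> mono \<Rightarrow> int list" where
  "exp_diff p s t = map (\<lambda>i. int (Poly_Mapping.lookup s i) - int (Poly_Mapping.lookup t i)) ([1..<Suc p] @ [0])"

definition rightmost_nonzero_neg :: "int list \<Rightarrow> bool" where
  "rightmost_nonzero_neg v \<longleftrightarrow>
     (\<exists>k<length v. v ! k < 0 \<and> (\<forall>l. k < l \<and> l < length v \<longrightarrow> v ! l = 0))"

definition gt_R :: "nat \<Rightarrow> (nat \<Rightarrow> nat) \<Rightarrow> mono \<Rightarrow> mono \<Rightarrow> bool" where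
  "gt_R p m s t \<longleftrightarrow> weight p m s > weight p m t \<or>
     (weight p m s = weight p m t \<and> rightmost_nonzero_neg (exp_diff p s t))"

section \<open>The generators of the defining ideal\<close>

definition eps :: "nat \<Rightarrow> nat \<Rightarrow> nat \<Rightarrow> nat" where
  "eps p i j = (if i + j < p then i + j else p)"

definition tau :: "nat \<Rightarrow> nat \<Rightarrow> nat \<Rightarrow> nat" where
  "tau p i j = (if i + j < p then 0 else p)"

definition phi :: "nat \<Rightarrow> nat \<Rightarrow> nat \<Rightarrow> 'k::field mpoly" where
  "phi p i j = X i * X j - X (eps p i j) * X (i + j - eps p i j)"

definition psi :: "nat \<Rightarrow> nat \<Rightarrow> nat \<Rightarrow> nat \<Rightarrow> nat \<Rightarrow> 'k::field mpoly" where
  "psi p a d b i = X (b + i) * X p ^ a - X i * X 0 ^ (a + d)"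

section \<open>Finitely supported vectors over the polynomial ring\<close>

type_synonym ('e, 'k) vec = "'e \<Rightarrow>\<^sub>0 'k mpoly"

definition smul :: "'k::field mpoly \<Rightarrow> ('e, 'k) vec \<Rightarrow> ('e, 'k) vec" (infixr "\<odot>" 75) where
  "r \<odot> v = Poly_Mapping.map ((*) r) v"

lemma lookup_smul: "Poly_Mapping.lookup (r \<odot> v) e = r * Poly_Mapping.lookup v e"
  by (simp add: smul_def Poly_Mapping.map.rep_eq when_def)

definition unit_vec :: "'e \<Rightarrow> ('e, 'k::field) vec" where
  "unit_vec e = Poly_Mapping.single e 1"

definition free_module :: "nat \<Rightarrow> 'e set \<Rightarrow> ('e, 'k::field) vec set" where
  "free_module p E = {v. Poly_Mapping.keys v \<subseteq> E \<and> (\<forall>e. Poly_Mapping.lookup v e \<in> polys p)}"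

definition submodule_gen :: "nat \<Rightarrow> ('e, 'k::field) vec set \<Rightarrow> ('e, 'k) vec set" where
  "submodule_gen p S =
     {\<Sum>v\<in>F. r v \<odot> v | F r. finite F \<and> F \<subseteq> S \<and> (\<forall>v\<in>F. r v \<in> polys p)}"

definition syzygies :: "nat \<Rightarrow> 'e set \<Rightarrow> ('e \<Rightarrow> 'k::field mpoly) \<Rightarrow> ('e, 'k) vec set" where
  "syzygies p E g = {v \<in> free_module p E. (\<Sum>e\<in>Poly_Mapping.keys v. Poly_Mapping.lookup v e * g e) = 0}"

section \<open>Leading terms and Groebner bases of submodules\<close>

text \<open>The pair \<open>(t, e)\<close> stands for the module monomial \<open>t e\<close>.\<close>

definition monomials :: "('e, 'k::field) vec \<Rightarrow> (mono \<times> 'e) set" where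
  "monomials v = {(t, e). t \<in> Poly_Mapping.keys (Poly_Mapping.lookup v e)}"

definition mon_dvd :: "mono \<times> 'e \<Rightarrow> mono \<times> 'e \<Rightarrow> bool" where
  "mon_dvd u w \<longleftrightarrow> snd u = snd w \<and> (\<exists>s. fst w = s + fst u)"

definition lead_mon ::
    "(mono \<times> 'e \<Rightarrow> mono \<times> 'e \<Rightarrow> bool) \<Rightarrow> ('e, 'k::field) vec \<Rightarrow> mono \<times> 'e" where
  "lead_mon gt v = (THE u. u \<in> monomials v \<and> (\<forall>w\<in>monomials v. w \<noteq> u \<longrightarrow> gt u w))"

text \<open>For \<open>v = 0\<close> the leading monomial is unspecified, but the leading coefficient and the
  leading term are \<open>0\<close>, whatever it is.\<close>

definition lead_coef ::
    "(mono \<times> 'e \<Rightarrow> mono \<times> 'e \<Rightarrow> bool) \<Rightarrow> ('e, 'k::field) vec \<Rightarrow> 'k" where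
  "lead_coef gt v = Poly_Mapping.lookup (Poly_Mapping.lookup v (snd (lead_mon gt v))) (fst (lead_mon gt v))"

definition lead_term ::
    "(mono \<times> 'e \<Rightarrow> mono \<times> 'e \<Rightarrow> bool) \<Rightarrow> ('e, 'k::field) vec \<Rightarrow> ('e, 'k) vec" where
  "lead_term gt v = Poly_Mapping.single (snd (lead_mon gt v))
                      (Poly_Mapping.single (fst (lead_mon gt v)) (lead_coef gt v))"

definition groebner_basis ::
    "nat \<Rightarrow> (mono \<times> 'e \<Rightarrow> mono \<times> 'e \<Rightarrow> bool) \<Rightarrow> ('e, 'k::field) vec set \<Rightarrow> ('e, 'k) vec set \<Rightarrow> bool"
  where
  "groebner_basis p gt N G \<longleftrightarrow> finite G \<and> G \<subseteq> N \<and>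
     submodule_gen p (lead_term gt ` G) = submodule_gen p (lead_term gt ` (N - {0}))"

definition minimal_groebner_basis ::
    "nat \<Rightarrow> (mono \<times> 'e \<Rightarrow> mono \<times> 'e \<Rightarrow> bool) \<Rightarrow> ('e, 'k::field) vec set \<Rightarrow> ('e, 'k) vec set \<Rightarrow> bool"
  where
  "minimal_groebner_basis p gt N G \<longleftrightarrow> groebner_basis p gt N G \<and>
     (\<forall>g\<in>G. lead_coef gt g = 1) \<and>
     (\<forall>g\<in>G. \<forall>h\<in>G. g \<noteq> h \<longrightarrow> \<not> mon_dvd (lead_mon gt g) (lead_mon gt h))"

section \<open>The first syzygy module\<close>

text \<open>\<open>Psi i\<close> is the symbol \<open>\<Psi>(b,i)\<close>; the number \<open>b\<close> is fixed throughout.\<close>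

datatype sym = Psi nat | Phi nat nat

definition basis_syms :: "nat \<Rightarrow> nat \<Rightarrow> sym set" where
  "basis_syms p b = {Psi i | i. i \<le> p - b} \<union> {Phi i j | i j. 1 \<le> i \<and> i \<le> j \<and> j \<le> p - 1}"

primrec gen_poly :: "nat \<Rightarrow> nat \<Rightarrow> nat \<Rightarrow> nat \<Rightarrow> sym \<Rightarrow> 'k::field mpoly" where
  "gen_poly p a d b (Psi i) = psi p a d b i"
| "gen_poly p a d b (Phi i j) = phi p i j"

text \<open>The module \<open>\<N>\<close>: the kernel of the \<open>R\<close>-linear map sending the basis symbols to the
  generators \<open>\<psi>(b,i)\<close> and \<open>\<phi>(i,j)\<close> of the kernel of \<open>X\<^sub>i \<mapsto> T\<^bsup>m_i\<^esup>\<close>.\<close>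

definition first_syzygy_module :: "nat \<Rightarrow> nat \<Rightarrow> nat \<Rightarrow> nat \<Rightarrow> (sym, 'k::field) vec set" where
  "first_syzygy_module p a d b = syzygies p (basis_syms p b) (gen_poly p a d b)"

primrec varpi_sym :: "nat \<Rightarrow> nat \<Rightarrow> nat \<Rightarrow> sym \<Rightarrow> mono" where
  "varpi_sym p a b (Psi i) = Poly_Mapping.single p a + Poly_Mapping.single (b + i) 1"
| "varpi_sym p a b (Phi i j) = Poly_Mapping.single i 1 + Poly_Mapping.single j 1"

definition varpi :: "nat \<Rightarrow> nat \<Rightarrow> nat \<Rightarrow> mono \<times> sym \<Rightarrow> mono" where
  "varpi p a b u = fst u + varpi_sym p a b (snd u)"

fun gt_sym :: "sym \<Rightarrow> sym \<Rightarrow> bool" where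
  "gt_sym (Psi i) (Psi j) \<longleftrightarrow> i < j"
| "gt_sym (Psi i) (Phi l j) \<longleftrightarrow> True"
| "gt_sym (Phi l j) (Psi i) \<longleftrightarrow> False"
| "gt_sym (Phi i j) (Phi i' j') \<longleftrightarrow> j > j' \<or> (j = j' \<and> i > i')"

definition gt_M ::
    "nat \<Rightarrow> nat \<Rightarrow> nat \<Rightarrow> (nat \<Rightarrow> nat) \<Rightarrow> mono \<times> sym \<Rightarrow> mono \<times> sym \<Rightarrow> bool" where
  "gt_M p a b m u w \<longleftrightarrow> gt_R p m (varpi p a b u) (varpi p a b w) \<or>
     (varpi p a b u = varpi p a b w \<and> gt_sym (snd u) (snd w))"

section \<open>The syzygies\<close>

abbreviation vPsi :: "nat \<Rightarrow> (sym, 'k::field) vec" where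
  "vPsi i \<equiv> unit_vec (Psi i)"

text \<open>\<open>\<Phi>(i,j)\<close> for arbitrary indices: symmetric, and \<open>0\<close> unless \<open>i, j \<in> [1, p - 1]\<close>.\<close>

definition vPhi :: "nat \<Rightarrow> nat \<Rightarrow> nat \<Rightarrow> (sym, 'k::field) vec" where
  "vPhi p i j = (if i \<in> {1..p - 1} \<and> j \<in> {1..p - 1} then unit_vec (Phi (min i j) (max i j)) else 0)"

text \<open>The truncated difference \<open>b + i + j - p\<close> in \<open>syzA\<close> is harmless: when \<open>b + i + j < p\<close> it is \<open>0\<close>,
  and \<open>vPhi\<close> vanishes there just as \<open>\<Phi>\<close> does at a negative index. All other differences
  below are non-negative in the ranges in which they are used.\<close>

definition syzA :: "nat \<Rightarrow> nat \<Rightarrow> nat \<Rightarrow> nat \<Rightarrow> nat \<Rightarrow> nat \<Rightarrow> (sym, 'k::field) vec" where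
  "syzA p a d b i j =
     X i \<odot> vPsi j
     - X (b + i + j - eps p i (b + j)) \<odot> vPsi (eps p i (b + j) - b)
     - X p ^ a \<odot> vPhi p i (b + j)
     + X 0 ^ (a + d) \<odot> (vPhi p i j - vPhi p (b + i + j - p) (p - b))"

definition syzB :: "nat \<Rightarrow> nat \<Rightarrow> nat \<Rightarrow> nat \<Rightarrow> nat \<Rightarrow> nat \<Rightarrow> (sym, 'k::field) vec" where
  "syzB p a d b i j =
     (X i * X j) \<odot> vPsi (p - b)
     - (X (eps p i j) * X (i + j - eps p i j)) \<odot> vPsi (p - b)
     - psi p a d b (p - b) \<odot> vPhi p i j"

definition syzL :: "nat \<Rightarrow> nat \<Rightarrow> nat \<Rightarrow> nat \<Rightarrow> (sym, 'k::field) vec" where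
  "syzL p l i j =
     X l \<odot> vPhi p i j
     - X j \<odot> vPhi p i l
     + X (tau p i j) \<odot> vPhi p (i + j - tau p i j) l
     - X (tau p i l) \<odot> vPhi p (i + l - tau p i l) j"

text \<open>The range \<open>j \<in> [0, p - b - 1]\<close> is written \<open>j < p - b\<close>, so that it is empty for \<open>b = p\<close>.\<close>

definition G_hat :: "nat \<Rightarrow> nat \<Rightarrow> nat \<Rightarrow> nat \<Rightarrow> (sym, 'k::field) vec set" where
  "G_hat p a d b =
     {syzA p a d b i j | i j. i \<in> {1..p} \<and> j < p - b}
     \<union> {syzB p a d b i j | i j. i \<in> {1..p - 1} \<and> j \<in> {1..p - 1}}
     \<union> {syzL p l i j | l i j. l \<in> {1..p - 1} \<and> i \<in> {1..p - 1} \<and> j \<in> {1..p - 1} \<and> i \<le> j \<and> l < j}"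

end

theory Submission
  imports Defs
begin

text \<open>No S-pairs are needed. Call a monomial of the free module standard if no leading monomial of an
  element of \<open>G_hat\<close> divides it. The map \<open>varpi\<close> is injective on the standard monomials, and \<open>varpi u\<close> is
  the leading monomial of the image of \<open>u\<close> in \<open>R\<close>; so a nonzero combination of standard monomials has
  nonzero image, that is, it is not a syzygy. On the other hand, dividing a syzygy by \<open>G_hat\<close> leaves a syzygy
  that is a combination of standard monomials, and its leading term is unchanged if the leading monomial
  was standard.\<close>

section \<open>Polynomial rings and free modules\<close>

text \<open>Every generator is a difference of two monomials of equal weight, and
  \<open>varpi_sym\<close> gives the first of them. At equal weight the order makes a monomial
  smaller the more \<open>X 0\<close> it contains, then the more \<open>X p\<close>; it is at one of
  these two variables that the second monomial has the larger exponent. This is why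
  \<open>varpi u\<close> leads the image of \<open>u\<close>. Injectivity is a comparison of
  exponents: when two distinct module monomials share their \<open>varpi\<close>, their symbols
  differ, and the one with the larger symbol must contain variables that the leading monomials of
  \<open>G_hat\<close> forbid over that symbol. Division terminates because the weights
  \<open>m i\<close> are positive, which leaves only finitely many module monomials below a given
  one.\<close>

lemma polys_zero [simp]: "0 \<in> polys p"
  and polys_one [simp]: "1 \<in> polys p"
  by (auto simp: polys_def)

lemma polys_add: "f \<in> polys p \<Longrightarrow> g \<in> polys p \<Longrightarrow> f + g \<in> polys p"
  using keys_add[of f g] by (auto simp: polys_def)

lemma polys_diff: "f \<in> polys p \<Longrightarrow> g \<in> polys p \<Longrightarrow> f - g \<in> polys p"
  using keys_diff[of f g] by (auto simp: polys_def)

lemma polys_mult: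
  assumes "f \<in> polys p" "g \<in> polys p"
  shows "f * g \<in> polys p"
  unfolding polys_def
proof (intro CollectI ballI)
  fix t assume "t \<in> Poly_Mapping.keys (f * g)"
  then obtain r s where "t = r + s" "r \<in> Poly_Mapping.keys f" "s \<in> Poly_Mapping.keys g"
    using keys_mult[of f g] by blast
  then show "Poly_Mapping.keys t \<subseteq> {0..p}"
    using assms keys_add[of r s] unfolding polys_def by blast
qed

lemma polys_power: "f \<in> polys p \<Longrightarrow> f ^ n \<in> polys p"
  by (induction n) (auto intro: polys_mult)

lemma polys_single: "Poly_Mapping.keys t \<subseteq> {0..p} \<Longrightarrow> Poly_Mapping.single t c \<in> polys p"
  by (auto simp: polys_def)

lemma polys_X: "i \<le> p \<Longrightarrow> X i \<in> polys p"
  unfolding X_def by (intro polys_single) auto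

lemma smul_add_right: "r \<odot> (v + w) = r \<odot> v + r \<odot> w"
  and smul_diff_right: "r \<odot> (v - w) = r \<odot> v - r \<odot> w"
  and smul_add_left: "(r + s) \<odot> v = r \<odot> v + s \<odot> v"
  and smul_diff_left: "(r - s) \<odot> v = r \<odot> v - s \<odot> v"
  and smul_smul: "r \<odot> (s \<odot> v) = (r * s) \<odot> v"
  and smul_zero_right [simp]: "r \<odot> 0 = 0"
  and smul_zero_left [simp]: "0 \<odot> v = 0"
  and smul_one [simp]: "1 \<odot> v = v"
  and smul_unit_vec: "r \<odot> unit_vec e = Poly_Mapping.single e r"
  by (rule poly_mapping_eqI;
      simp add: lookup_smul lookup_add lookup_minus algebra_simps unit_vec_def lookup_single when_def)+

lemma smul_sum: "r \<odot> sum f A = (\<Sum>x\<in>A. r \<odot> f x)"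
  by (induction A rule: infinite_finite_induct) (auto simp: smul_add_right)

lemma free_module_zero: "0 \<in> free_module p E"
  by (simp add: free_module_def)

lemma free_module_add: "v \<in> free_module p E \<Longrightarrow> w \<in> free_module p E \<Longrightarrow> v + w \<in> free_module p E"
  using keys_add[of v w] by (auto simp: free_module_def lookup_add intro: polys_add)

lemma free_module_diff: "v \<in> free_module p E \<Longrightarrow> w \<in> free_module p E \<Longrightarrow> v - w \<in> free_module p E"
  using keys_diff[of v w] by (auto simp: free_module_def lookup_minus intro: polys_diff)

lemma free_module_smul: "r \<in> polys p \<Longrightarrow> v \<in> free_module p E \<Longrightarrow> r \<odot> v \<in> free_module p E"
  by (fastforce simp: free_module_def lookup_smul in_keys_iff intro: polys_mult)

lemma free_module_unit_vec: "e \<in> E \<Longrightarrow> unit_vec e \<in> free_module p E"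
  by (auto simp: free_module_def unit_vec_def lookup_single when_def)

definition is_submodule :: "nat \<Rightarrow> ('e, 'k::field) vec set \<Rightarrow> bool" where
  "is_submodule p N \<longleftrightarrow> 0 \<in> N \<and> (\<forall>v\<in>N. \<forall>w\<in>N. v + w \<in> N) \<and> (\<forall>r\<in>polys p. \<forall>v\<in>N. r \<odot> v \<in> N)"

lemma is_submodule_sum:
  assumes "is_submodule p N" "\<And>i. i \<in> I \<Longrightarrow> f i \<in> N"
  shows "sum f I \<in> N"
  using assms by (induction I rule: infinite_finite_induct) (auto simp: is_submodule_def)

lemma is_submodule_diff:
  assumes "is_submodule p N" "v \<in> N" "w \<in> N"
  shows "v - w \<in> N"
proof -
  have "v + (0 - 1) \<odot> w \<in> N"
    using assms polys_diff[OF polys_zero polys_one] unfolding is_submodule_def by blast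
  then show ?thesis by (simp only: smul_diff_left) simp
qed

lemma submodule_gen_submodule: "is_submodule p (submodule_gen p S)"
  unfolding is_submodule_def
proof (intro conjI ballI)
  show "0 \<in> submodule_gen p S"
    unfolding submodule_gen_def by (auto intro!: exI[of _ "{}"])
next
  fix v w assume "v \<in> submodule_gen p S" "w \<in> submodule_gen p S"
  then obtain F r F' r' where F: "finite F" "F \<subseteq> S" "\<forall>v\<in>F. r v \<in> polys p" "v = (\<Sum>v\<in>F. r v \<odot> v)"
    and F': "finite F'" "F' \<subseteq> S" "\<forall>v\<in>F'. r' v \<in> polys p" "w = (\<Sum>v\<in>F'. r' v \<odot> v)"
    unfolding submodule_gen_def by auto
  \<comment> \<open>A vector may occur in both sums; its coefficients are then added, and an absent
    vector gets coefficient 0.\<close>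
  define q where "q = (\<lambda>v. (if v \<in> F then r v else 0) + (if v \<in> F' then r' v else 0))"
  have "v = (\<Sum>v\<in>F \<union> F'. (if v \<in> F then r v else 0) \<odot> v)"
    unfolding F(4) using F(1) F'(1) by (intro sum.mono_neutral_cong_left) auto
  moreover have "w = (\<Sum>v\<in>F \<union> F'. (if v \<in> F' then r' v else 0) \<odot> v)"
    unfolding F'(4) using F(1) F'(1) by (intro sum.mono_neutral_cong_left) auto
  ultimately have "v + w = (\<Sum>v\<in>F \<union> F'. q v \<odot> v)"
    by (simp add: q_def smul_add_left sum.distrib)
  moreover have "\<forall>v\<in>F \<union> F'. q v \<in> polys p"
    using F(3) F'(3) by (auto simp: q_def intro: polys_add)
  ultimately show "v + w \<in> submodule_gen p S"
    using F(1,2) F'(1,2) unfolding submodule_gen_def by blast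
next
  fix v :: "('a, 'b) vec" and c :: "'b mpoly" assume "c \<in> polys p" "v \<in> submodule_gen p S"
  then obtain F r where F: "finite F" "F \<subseteq> S" "\<forall>v\<in>F. r v \<in> polys p" "v = (\<Sum>v\<in>F. r v \<odot> v)"
    unfolding submodule_gen_def by auto
  have "c \<odot> v = (\<Sum>v\<in>F. (c * r v) \<odot> v)"
    by (simp add: F(4) smul_sum smul_smul)
  moreover have "\<forall>v\<in>F. c * r v \<in> polys p"
    using F(3) \<open>c \<in> polys p\<close> by (auto intro: polys_mult)
  ultimately show "c \<odot> v \<in> submodule_gen p S"
    using F(1,2) unfolding submodule_gen_def mem_Collect_eq
    by (intro exI[of _ F] exI[of _ "\<lambda>v. c * r v"]) simp
qed

lemma submodule_gen_superset: "S \<subseteq> submodule_gen p S"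
proof
  fix v assume "v \<in> S"
  then show "v \<in> submodule_gen p S"
    unfolding submodule_gen_def by (intro CollectI exI[of _ "{v}"] exI[of _ "\<lambda>_. 1"]) simp
qed

lemma submodule_gen_least:
  assumes "is_submodule p N" "S \<subseteq> N"
  shows "submodule_gen p S \<subseteq> N"
proof
  fix v assume "v \<in> submodule_gen p S"
  then obtain F r where F: "F \<subseteq> S" "\<forall>v\<in>F. r v \<in> polys p" "v = (\<Sum>v\<in>F. r v \<odot> v)"
    unfolding submodule_gen_def by auto
  show "v \<in> N"
    unfolding F(3) using assms F(1,2)
    by (intro is_submodule_sum[OF assms(1)]) (auto simp: is_submodule_def)
qed

text \<open>\<open>mterm\<close> and \<open>coef\<close> flatten the nested finite maps: a vector
  becomes a finitely supported function on pairs of a monomial and a symbol.\<close>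

definition mterm :: "'k::field \<Rightarrow> mono \<times> 'e \<Rightarrow> ('e, 'k) vec" where
  "mterm c u = Poly_Mapping.single (snd u) (Poly_Mapping.single (fst u) c)"

definition coef :: "('e, 'k::field) vec \<Rightarrow> mono \<times> 'e \<Rightarrow> 'k" where
  "coef v u = Poly_Mapping.lookup (Poly_Mapping.lookup v (snd u)) (fst u)"

lemma vec_eqI:
  assumes "\<And>u. coef v u = coef w u"
  shows "v = w"
proof (intro poly_mapping_eqI)
  fix e t
  show "Poly_Mapping.lookup (Poly_Mapping.lookup v e) t = Poly_Mapping.lookup (Poly_Mapping.lookup w e) t"
    using assms[of "(t, e)"] by (simp add: coef_def)
qed

lemma coef_mterm: "coef (mterm c u) w = (if u = w then c else 0)"
  by (cases u; cases w) (auto simp: coef_def mterm_def lookup_single when_def)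

lemma coef_zero [simp]: "coef 0 u = 0"
  and coef_add: "coef (v + w) u = coef v u + coef w u"
  and coef_diff: "coef (v - w) u = coef v u - coef w u"
  and coef_sum: "coef (sum f A) u = (\<Sum>i\<in>A. coef (f i) u)"
  by (simp_all add: coef_def lookup_add lookup_minus lookup_sum)

lemma monomials_iff_coef: "u \<in> monomials v \<longleftrightarrow> coef v u \<noteq> 0"
  by (cases u) (simp add: monomials_def coef_def in_keys_iff)

lemma monomials_mterm: "monomials (mterm c u) \<subseteq> {u}"
  by (auto simp: monomials_iff_coef coef_mterm split: if_splits)

lemma monomials_add: "monomials (v + w) \<subseteq> monomials v \<union> monomials w"
  and monomials_diff: "monomials (v - w) \<subseteq> monomials v \<union> monomials w"
  by (auto simp: monomials_iff_coef coef_add coef_diff)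

lemma monomials_sum: "monomials (sum f A) \<subseteq> (\<Union>i\<in>A. monomials (f i))"
proof
  fix u assume "u \<in> monomials (sum f A)"
  then have "(\<Sum>i\<in>A. coef (f i) u) \<noteq> 0" by (simp add: monomials_iff_coef coef_sum)
  then obtain i where "i \<in> A" "coef (f i) u \<noteq> 0" by (rule sum.not_neutral_contains_not_neutral)
  then show "u \<in> (\<Union>i\<in>A. monomials (f i))" by (auto simp: monomials_iff_coef)
qed

lemma monomials_diff_mterm: "monomials (v - mterm (coef v u) u) = monomials v - {u}"
  by (rule set_eqI) (simp add: monomials_iff_coef coef_diff coef_mterm)

lemma monomials_eq_empty_iff: "monomials v = {} \<longleftrightarrow> v = 0"
proof
  assume "monomials v = {}"
  then show "v = 0" by (intro vec_eqI) (auto simp: monomials_iff_coef)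
qed (simp add: monomials_def)

lemma finite_monomials: "finite (monomials v)"
proof -
  have "monomials v \<subseteq> (\<lambda>(e, t). (t, e)) ` (SIGMA e:Poly_Mapping.keys v. Poly_Mapping.keys (Poly_Mapping.lookup v e))"
    by (force simp: monomials_def in_keys_iff image_iff)
  then show ?thesis by (rule finite_subset) auto
qed

text \<open>Reduction acts on one module monomial at a time; this sum extends it to whole vectors by
  linearity.\<close>

lemma vec_decomposition: "v = (\<Sum>u\<in>monomials v. mterm (coef v u) u)"
  by (intro vec_eqI) (auto simp: coef_sum coef_mterm sum.delta[OF finite_monomials] monomials_iff_coef)

definition mons :: "nat \<Rightarrow> 'e set \<Rightarrow> (mono \<times> 'e) set" where
  "mons p E = {(t, e). Poly_Mapping.keys t \<subseteq> {0..p} \<and> e \<in> E}"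

lemma free_module_iff: "v \<in> free_module p E \<longleftrightarrow> monomials v \<subseteq> mons p E"
proof
  show "v \<in> free_module p E \<Longrightarrow> monomials v \<subseteq> mons p E"
    by (fastforce simp: free_module_def monomials_def mons_def polys_def in_keys_iff)
  assume *: "monomials v \<subseteq> mons p E"
  have "e \<in> E" if e: "e \<in> Poly_Mapping.keys v" for e
  proof -
    have "Poly_Mapping.lookup v e \<noteq> 0" using e by (simp add: in_keys_iff)
    then obtain t where "t \<in> Poly_Mapping.keys (Poly_Mapping.lookup v e)"
      by (metis all_not_in_conv keys_eq_empty)
    then show ?thesis using * by (auto simp: monomials_def mons_def)
  qed
  then show "v \<in> free_module p E"
    using * by (auto simp: free_module_def monomials_def mons_def polys_def)
qed

lemma smul_mterm: "Poly_Mapping.single r c \<odot> mterm k u = mterm (c * k) (r + fst u, snd u)"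
  by (rule poly_mapping_eqI) (auto simp: mterm_def lookup_smul lookup_single when_def mult_single)

text \<open>Only an inclusion, since \<open>c\<close> may be 0.\<close>

lemma monomials_single_smul:
  "monomials (Poly_Mapping.single r c \<odot> v) \<subseteq> (\<lambda>(t, e). (r + t, e)) ` monomials v"
proof -
  have "Poly_Mapping.single r c \<odot> v = (\<Sum>u\<in>monomials v. mterm (c * coef v u) (r + fst u, snd u))"
    by (subst vec_decomposition) (simp add: smul_sum smul_mterm)
  then show ?thesis
    using monomials_sum[of "\<lambda>u. mterm (c * coef v u) (r + fst u, snd u)" "monomials v"] monomials_mterm
    by (fastforce simp: case_prod_unfold)
qed

text \<open>The linear map with values \<open>g\<close> on the basis; its kernel in the free module
  is \<open>syzygies p E g\<close>.\<close>

definition lin_ext :: "('e \<Rightarrow> 'k::field mpoly) \<Rightarrow> ('e, 'k) vec \<Rightarrow> 'k mpoly" where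
  "lin_ext g v = (\<Sum>e\<in>Poly_Mapping.keys v. Poly_Mapping.lookup v e * g e)"

text \<open>The supports of \<open>v\<close>, \<open>w\<close> and \<open>v + w\<close> differ;
  summing over a common finite superset makes additivity visible.\<close>

lemma lin_ext_superset:
  assumes "finite E" "Poly_Mapping.keys v \<subseteq> E"
  shows "lin_ext g v = (\<Sum>e\<in>E. Poly_Mapping.lookup v e * g e)"
  unfolding lin_ext_def using assms by (intro sum.mono_neutral_left) (auto simp: in_keys_iff)

lemma lin_ext_add: "lin_ext g (v + w) = lin_ext g v + lin_ext g w"
proof -
  let ?E = "Poly_Mapping.keys v \<union> Poly_Mapping.keys w"
  show ?thesis
    using keys_add[of v w] lin_ext_superset[of ?E "v + w" g] lin_ext_superset[of ?E v g]
      lin_ext_superset[of ?E w g]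
    by (simp add: lookup_add algebra_simps sum.distrib)
qed

lemma lin_ext_smul: "lin_ext g (r \<odot> v) = r * lin_ext g v"
proof -
  have "Poly_Mapping.keys (r \<odot> v) \<subseteq> Poly_Mapping.keys v"
    by (auto simp: in_keys_iff lookup_smul)
  then show ?thesis
    using lin_ext_superset[of "Poly_Mapping.keys v" "r \<odot> v" g]
    by (simp add: lookup_smul lin_ext_def sum_distrib_left mult.assoc)
qed

lemma lin_ext_zero [simp]: "lin_ext g 0 = 0"
  by (simp add: lin_ext_def)

lemma lin_ext_diff: "lin_ext g (v - w) = lin_ext g v - lin_ext g w"
  using lin_ext_add[of g "v - w" w] by simp

lemma lin_ext_sum: "lin_ext g (sum f A) = (\<Sum>i\<in>A. lin_ext g (f i))"
  by (induction A rule: infinite_finite_induct) (auto simp: lin_ext_add)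

lemma lin_ext_unit_vec [simp]: "lin_ext g (unit_vec e) = g e"
  by (simp add: lin_ext_def unit_vec_def)

lemma lin_ext_decomposition:
  "lin_ext g v = (\<Sum>u\<in>monomials v. Poly_Mapping.single (fst u) (coef v u) * g (snd u))"
  by (subst vec_decomposition)
     (simp add: lin_ext_sum mterm_def lin_ext_smul flip: smul_unit_vec)

lemma syzygies_iff: "v \<in> syzygies p E g \<longleftrightarrow> v \<in> free_module p E \<and> lin_ext g v = 0"
  by (simp add: syzygies_def lin_ext_def)

lemma syzygies_submodule: "is_submodule p (syzygies p E g)"
  by (auto simp: is_submodule_def syzygies_iff lin_ext_add lin_ext_smul
      intro: free_module_zero free_module_add free_module_smul)

section \<open>Groebner bases of submodules\<close>

lemma finite_has_greatest:
  assumes "finite A" "A \<noteq> {}"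
    and trans: "\<And>x y z. gt x y \<Longrightarrow> gt y z \<Longrightarrow> gt x z"
    and total: "\<And>x y. x \<in> A \<Longrightarrow> y \<in> A \<Longrightarrow> x \<noteq> y \<Longrightarrow> gt x y \<or> gt y x"
  shows "\<exists>x\<in>A. \<forall>y\<in>A. y \<noteq> x \<longrightarrow> gt x y"
  using assms(1,2) total
proof (induction rule: finite_ne_induct)
  case (insert x F)
  then obtain z where z: "z \<in> F" "\<forall>y\<in>F. y \<noteq> z \<longrightarrow> gt z y" by blast
  then consider "gt x z" | "gt z x" using insert by (metis insertCI)
  then show ?case
  proof cases
    case 1
    then have "\<forall>y\<in>insert x F. y \<noteq> x \<longrightarrow> gt x y" using z(2) trans 1 by (metis insertE)
    then show ?thesis by blast
  next
    case 2
    then have "\<forall>y\<in>insert x F. y \<noteq> z \<longrightarrow> gt z y" using z by blast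
    then show ?thesis using z by blast
  qed
qed simp

text \<open>Totality is asked only on \<open>mons p E\<close>, because an order that looks at the
  variables up to \<open>p\<close> cannot separate other monomials. Finiteness of the lower sets
  takes the place of a well-ordering: their cardinality serves as induction measure.\<close>

locale module_order =
  fixes p :: nat and E :: "'e set" and gt :: "mono \<times> 'e \<Rightarrow> mono \<times> 'e \<Rightarrow> bool"
  assumes irrefl: "\<not> gt u u"
    and trans: "gt u v \<Longrightarrow> gt v w \<Longrightarrow> gt u w"
    and total: "u \<in> mons p E \<Longrightarrow> w \<in> mons p E \<Longrightarrow> u \<noteq> w \<Longrightarrow> gt u w \<or> gt w u"
    and mult: "gt (s, e) (t, f) \<Longrightarrow> gt (r + s, e) (r + t, f)"
    and finite_below: "u \<in> mons p E \<Longrightarrow> finite {w \<in> mons p E. gt u w}"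
begin

definition below :: "mono \<times> 'e \<Rightarrow> ('e, 'k::field) vec \<Rightarrow> bool" where
  "below u v \<longleftrightarrow> (\<forall>w\<in>monomials v. gt u w)"

lemma below_zero [simp]: "below u 0"
  by (simp add: below_def monomials_def)

lemma below_add: "below u v \<Longrightarrow> below u w \<Longrightarrow> below u (v + w)"
  using monomials_add[of v w] by (auto simp: below_def)

lemma below_diff: "below u v \<Longrightarrow> below u w \<Longrightarrow> below u (v - w)"
  using monomials_diff[of v w] by (auto simp: below_def)

lemma below_mterm: "gt u w \<Longrightarrow> below u (mterm c w)"
  using monomials_mterm[of c w] by (auto simp: below_def)

lemma lead_mon_eqI:
  assumes "u \<in> monomials v" "\<And>w. w \<in> monomials v \<Longrightarrow> w \<noteq> u \<Longrightarrow> gt u w"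
  shows "lead_mon gt v = u"
  unfolding lead_mon_def
proof (rule the_equality)
  fix w assume "w \<in> monomials v \<and> (\<forall>y\<in>monomials v. y \<noteq> w \<longrightarrow> gt w y)"
  then show "w = u" using assms irrefl trans by metis
qed (use assms in auto)

text \<open>The leading monomials of \<open>G_hat\<close> are computed this way: split off the first
  written term and bound each of the others strictly.\<close>

lemma lead_monomial_below:
  assumes "below u v"
  shows "lead_mon gt (mterm 1 u + v) = u" and "lead_coef gt (mterm 1 u + v) = 1"
proof -
  have "coef v u = 0" using assms irrefl by (metis below_def monomials_iff_coef)
  then have c: "coef (mterm 1 u + v) u = 1" by (simp add: coef_add coef_mterm)
  show lm: "lead_mon gt (mterm 1 u + v) = u"
  proof (rule lead_mon_eqI)
    show "u \<in> monomials (mterm 1 u + v)" using c by (simp add: monomials_iff_coef)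
    fix w assume "w \<in> monomials (mterm 1 u + v)" "w \<noteq> u"
    then show "gt u w"
      using monomials_add[of "mterm 1 u" v] monomials_mterm[of 1 u] assms by (auto simp: below_def)
  qed
  show "lead_coef gt (mterm 1 u + v) = 1"
    using c by (simp add: lead_coef_def lm coef_def)
qed

lemma lead_mon_greatest:
  assumes "v \<in> free_module p E" "v \<noteq> 0"
  shows "lead_mon gt v \<in> monomials v" and "below (lead_mon gt v) (v - mterm (lead_coef gt v) (lead_mon gt v))"
proof -
  have "\<exists>u\<in>monomials v. \<forall>w\<in>monomials v. w \<noteq> u \<longrightarrow> gt u w"
  proof (rule finite_has_greatest)
    show "\<And>x y. x \<in> monomials v \<Longrightarrow> y \<in> monomials v \<Longrightarrow> x \<noteq> y \<Longrightarrow> gt x y \<or> gt y x"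
      using assms(1) total unfolding free_module_iff by blast
  qed (use finite_monomials monomials_eq_empty_iff assms(2) trans in blast)+
  then obtain u where u: "u \<in> monomials v" "\<forall>w\<in>monomials v. w \<noteq> u \<longrightarrow> gt u w" by blast
  then have lm: "lead_mon gt v = u" by (intro lead_mon_eqI) auto
  then show "lead_mon gt v \<in> monomials v" using u by simp
  have "lead_coef gt v = coef v u" by (simp add: lead_coef_def coef_def lm)
  then show "below (lead_mon gt v) (v - mterm (lead_coef gt v) (lead_mon gt v))"
    using u by (simp add: below_def lm monomials_diff_mterm)
qed

lemma lead_term_eq: "lead_term gt v = mterm (lead_coef gt v) (lead_mon gt v)"
  by (simp add: lead_term_def mterm_def)

context
  fixes N G :: "('e, 'k::field) vec set"
  assumes N: "is_submodule p N" "N \<subseteq> free_module p E"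
    and G: "G \<subseteq> N" "\<And>g. g \<in> G \<Longrightarrow> lead_coef gt g = 1"
begin

abbreviation standard :: "mono \<times> 'e \<Rightarrow> bool" where
  "standard u \<equiv> \<forall>g\<in>G. \<not> mon_dvd (lead_mon gt g) u"

text \<open>The normal form of a single term modulo \<open>G\<close>. The alternative
  \<open>w = u\<close> is there for a \<open>u\<close> that is itself standard.\<close>

lemma reduce_monomial:
  assumes "u \<in> mons p E"
  shows "\<exists>s. s \<in> free_module p E \<and> mterm c u - s \<in> N \<and>
    (\<forall>w\<in>monomials s. standard w \<and> (w = u \<or> gt u w))"
  using assms
proof (induction "card {w \<in> mons p E. gt u w}" arbitrary: u c rule: less_induct)
  case less
  have mterm_free: "mterm k w \<in> free_module p E" if "w \<in> mons p E" for k :: 'k and w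
    using monomials_mterm[of k w] that by (auto simp: free_module_iff)
  show ?case
  proof (cases "standard u")
    case True
    then show ?thesis
      using monomials_mterm[of c u] N(1) mterm_free less.prems
      by (intro exI[of _ "mterm c u"]) (auto simp: is_submodule_def)
  next
    case False
    then obtain g r where g: "g \<in> G" "snd (lead_mon gt g) = snd u" "fst u = r + fst (lead_mon gt g)"
      by (auto simp: mon_dvd_def)
    let ?q = "Poly_Mapping.single r c"
    have gN: "g \<in> N" "g \<in> free_module p E" using g(1) G(1) N(2) by auto
    have "g \<noteq> 0" using G(2)[OF g(1)] by (auto simp: lead_coef_def)
    define rest where "rest = g - mterm 1 (lead_mon gt g)"
    have rest: "below (lead_mon gt g) rest"
      using lead_mon_greatest(2)[OF gN(2) \<open>g \<noteq> 0\<close>] G(2)[OF g(1)] by (simp add: rest_def)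
    have "Poly_Mapping.keys r \<subseteq> Poly_Mapping.keys (fst u)"
      unfolding g(3) by (auto simp: in_keys_iff lookup_add)
    also have "\<dots> \<subseteq> {0..p}" using less.prems by (cases u) (simp add: mons_def)
    finally have q: "?q \<in> polys p" by (rule polys_single)
    then have qg: "?q \<odot> g \<in> N" using gN(1) N(1) by (auto simp: is_submodule_def)
    \<comment> \<open>Subtracting this multiple of \<open>g\<close> cancels the term
      \<open>c u\<close>; up to sign the shifted tail of \<open>g\<close> remains, all of it below
      \<open>u\<close>.\<close>
    define h where "h = mterm c u - ?q \<odot> g"
    have h_free: "h \<in> free_module p E"
      using qg N(2) mterm_free[OF less.prems] unfolding h_def by (blast intro: free_module_diff)
    have "?q \<odot> rest = ?q \<odot> g - mterm c u"
      by (simp add: rest_def smul_diff_right smul_mterm g(2) flip: g(3))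
    then have "h = 0 - ?q \<odot> rest" by (simp add: h_def)
    then have "monomials h \<subseteq> (\<lambda>(t, e). (r + t, e)) ` monomials rest"
      using monomials_diff[of 0 "?q \<odot> rest"] monomials_single_smul[of r c rest]
      by (auto simp: monomials_def)
    moreover have "gt u (r + t, e)" if "(t, e) \<in> monomials rest" for t e
    proof -
      have "gt (lead_mon gt g) (t, e)" using rest that by (auto simp: below_def)
      then have "gt (r + fst (lead_mon gt g), snd (lead_mon gt g)) (r + t, e)"
        by (intro mult) simp
      then show ?thesis by (simp add: g(2) flip: g(3))
    qed
    ultimately have h_below: "\<And>w. w \<in> monomials h \<Longrightarrow> gt u w" by auto
    have "\<exists>s. s \<in> free_module p E \<and> mterm (coef h w) w - s \<in> N \<and>
        (\<forall>x\<in>monomials s. standard x \<and> gt u x)" if w: "w \<in> monomials h" for w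
    proof -
      have wm: "w \<in> mons p E" using h_free w by (auto simp: free_module_iff)
      \<comment> \<open>The lower set shrinks strictly: \<open>w\<close> lies below \<open>u\<close>
        but not below itself.\<close>
      have "{x \<in> mons p E. gt w x} \<subset> {x \<in> mons p E. gt u x}"
        using h_below[OF w] trans irrefl wm by blast
      then have "card {x \<in> mons p E. gt w x} < card {x \<in> mons p E. gt u x}"
        by (intro psubset_card_mono finite_below less.prems)
      then obtain s where "s \<in> free_module p E" "mterm (coef h w) w - s \<in> N"
          "\<forall>x\<in>monomials s. standard x \<and> (x = w \<or> gt w x)"
        using less.hyps[of w "coef h w"] wm by blast
      then show ?thesis using h_below[OF w] by (intro exI[of _ s]) (auto intro: trans[of u w])
    qed
    then obtain s where s: "\<And>w. w \<in> monomials h \<Longrightarrow> s w \<in> free_module p E"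
        "\<And>w. w \<in> monomials h \<Longrightarrow> mterm (coef h w) w - s w \<in> N"
        "\<And>w x. w \<in> monomials h \<Longrightarrow> x \<in> monomials (s w) \<Longrightarrow> standard x \<and> gt u x"
      by metis
    \<comment> \<open>Cancellation in this sum is harmless: its support lies in the union of the
      supports, which are standard.\<close>
    define S where "S = (\<Sum>w\<in>monomials h. s w)"
    have "h - S = (\<Sum>w\<in>monomials h. mterm (coef h w) w - s w)"
      unfolding S_def sum_subtractf by (subst (1) vec_decomposition) simp
    then have "h - S \<in> N" using is_submodule_sum[OF N(1) s(2)] by simp
    then have "(h - S) + ?q \<odot> g \<in> N" using qg N(1) unfolding is_submodule_def by blast
    then have "mterm c u - S \<in> N" by (simp add: h_def algebra_simps)
    moreover have S_mons: "monomials S \<subseteq> (\<Union>w\<in>monomials h. monomials (s w))"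
      unfolding S_def by (rule monomials_sum)
    then have "S \<in> free_module p E" using s(1) by (fastforce simp: free_module_iff)
    moreover have "\<forall>w\<in>monomials S. standard w \<and> (w = u \<or> gt u w)"
      using S_mons s(3) by blast
    ultimately show ?thesis by blast
  qed
qed

text \<open>A standard leading monomial would survive the reduction of all the other terms.\<close>

lemma groebner_basisI:
  assumes "finite G"
    and standard_zero: "\<And>v. v \<in> N \<Longrightarrow> \<forall>u\<in>monomials v. standard u \<Longrightarrow> v = 0"
  shows "groebner_basis p gt N G"
proof -
  have lead: "lead_term gt v \<in> submodule_gen p (lead_term gt ` G)" if v: "v \<in> N" "v \<noteq> 0" for v
  proof -
    have vF: "v \<in> free_module p E" using v N(2) by blast
    define u where "u = lead_mon gt v"
    define c where "c = lead_coef gt v"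
    define rest where "rest = v - mterm c u"
    have u: "u \<in> monomials v" and rest: "below u rest"
      using lead_mon_greatest[OF vF v(2)] by (simp_all add: u_def c_def rest_def)
    have c: "c \<noteq> 0" using u by (simp add: c_def u_def lead_coef_def monomials_iff_coef coef_def)
    have u_mons: "u \<in> mons p E" using u vF by (auto simp: free_module_iff)
    have cu: "c = coef v u" by (simp add: c_def u_def lead_coef_def coef_def)
    have "\<not> standard u"
    proof
      assume std: "standard u"
      have "\<exists>s. s \<in> free_module p E \<and> mterm (coef rest w) w - s \<in> N \<and>
        (\<forall>x\<in>monomials s. standard x \<and> gt u x)" if w: "w \<in> monomials rest" for w
      proof -
        have "w \<in> mons p E"
          using w vF by (auto simp: rest_def cu monomials_diff_mterm free_module_iff)
        then obtain s where "s \<in> free_module p E" "mterm (coef rest w) w - s \<in> N"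
            "\<forall>x\<in>monomials s. standard x \<and> (x = w \<or> gt w x)"
          using reduce_monomial[of w "coef rest w"] by blast
        moreover have "gt u w" using rest w by (auto simp: below_def)
        ultimately show ?thesis by (intro exI[of _ s]) (auto intro: trans[of u w])
      qed
      then obtain s where s: "\<And>w. w \<in> monomials rest \<Longrightarrow> mterm (coef rest w) w - s w \<in> N"
          "\<And>w x. w \<in> monomials rest \<Longrightarrow> x \<in> monomials (s w) \<Longrightarrow> standard x \<and> gt u x"
        by metis
      define S where "S = (\<Sum>w\<in>monomials rest. s w)"
      have S_mons: "monomials S \<subseteq> (\<Union>w\<in>monomials rest. monomials (s w))"
        unfolding S_def by (rule monomials_sum)
      have "rest - S = (\<Sum>w\<in>monomials rest. mterm (coef rest w) w - s w)"
        unfolding S_def sum_subtractf by (subst (1) vec_decomposition) simp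
      then have "rest - S \<in> N" using is_submodule_sum[OF N(1) s(1)] by simp
      \<comment> \<open>This difference is \<open>c u + S\<close>: an element of \<open>N\<close>
        with standard monomials only, in which \<open>u\<close> has the nonzero coefficient
        \<open>c\<close>.\<close>
      then have "v - (rest - S) \<in> N" using is_submodule_diff[OF N(1) v(1)] by blast
      then have "mterm c u + S \<in> N" by (simp add: rest_def add.commute)
      moreover have "\<forall>w\<in>monomials (mterm c u + S). standard w"
        using monomials_add[of "mterm c u" S] monomials_mterm[of c u] S_mons s(2) std by blast
      ultimately have "mterm c u + S = 0" by (intro standard_zero)
      moreover have "u \<notin> monomials S"
        using S_mons s(2) irrefl by blast
      then have "coef S u = 0" by (simp add: monomials_iff_coef)
      ultimately show False
        using c coef_add[of "mterm c u" S u] by (simp add: coef_mterm)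
    qed
    then obtain g r where g: "g \<in> G" "snd (lead_mon gt g) = snd u" "fst u = r + fst (lead_mon gt g)"
      by (auto simp: mon_dvd_def)
    have "Poly_Mapping.keys r \<subseteq> Poly_Mapping.keys (fst u)"
      unfolding g(3) by (auto simp: in_keys_iff lookup_add)
    also have "\<dots> \<subseteq> {0..p}" using u_mons by (cases u) (simp add: mons_def)
    finally have "Poly_Mapping.single r c \<in> polys p" by (rule polys_single)
    moreover have "lead_term gt v = Poly_Mapping.single r c \<odot> lead_term gt g"
      by (simp add: lead_term_eq G(2)[OF g(1)] smul_mterm g(2) flip: u_def c_def g(3))
    ultimately show ?thesis
      using submodule_gen_submodule[of p "lead_term gt ` G"] submodule_gen_superset[of "lead_term gt ` G" p] g(1)
      unfolding is_submodule_def by auto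
  qed
  \<comment> \<open>The zero vector has leading coefficient 0, so it is not in \<open>G\<close>, and
    the leading terms of \<open>G\<close> are among those of the nonzero elements of
    \<open>N\<close>.\<close>
  have "g \<noteq> 0" if "g \<in> G" for g
    using G(2)[OF that] by (auto simp: lead_coef_def)
  then have "submodule_gen p (lead_term gt ` G) \<subseteq> submodule_gen p (lead_term gt ` (N - {0}))"
    using G(1) submodule_gen_superset[of "lead_term gt ` (N - {0})" p]
    by (intro submodule_gen_least submodule_gen_submodule) auto
  moreover have "submodule_gen p (lead_term gt ` (N - {0})) \<subseteq> submodule_gen p (lead_term gt ` G)"
    using lead by (intro submodule_gen_least submodule_gen_submodule) auto
  ultimately show ?thesis using assms(1) G(1) by (auto simp: groebner_basis_def)
qed

end

end

section \<open>The monomial orders\<close>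

text \<open>The position \<open>k\<close> of the list \<open>exp_diff p s t\<close> belongs to this variable.\<close>

definition var_at :: "nat \<Rightarrow> nat \<Rightarrow> nat" where
  "var_at p k = (if k < p then Suc k else 0)"

lemma rightmost_exp_diff_iff:
  "rightmost_nonzero_neg (exp_diff p s t) \<longleftrightarrow>
     (\<exists>k\<le>p. Poly_Mapping.lookup s (var_at p k) < Poly_Mapping.lookup t (var_at p k) \<and>
       (\<forall>l. k < l \<and> l \<le> p \<longrightarrow> Poly_Mapping.lookup s (var_at p l) = Poly_Mapping.lookup t (var_at p l)))"
proof -
  have len: "length (exp_diff p s t) = Suc p" by (simp add: exp_diff_def)
  have nth: "exp_diff p s t ! k =
      int (Poly_Mapping.lookup s (var_at p k)) - int (Poly_Mapping.lookup t (var_at p k))" if "k \<le> p" for k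
  proof -
    have "([1..<Suc p] @ [0]) ! k = var_at p k"
      using that by (simp add: nth_append var_at_def del: upt_Suc)
    then show ?thesis
      unfolding exp_diff_def using that by (subst nth_map) (auto simp del: upt_Suc)
  qed
  show ?thesis
    unfolding rightmost_nonzero_neg_def len less_Suc_eq_le by (auto simp: nth)
qed

lemma gt_R_irrefl: "\<not> gt_R p m s s"
  by (simp add: gt_R_def rightmost_exp_diff_iff)

lemma gt_R_trans:
  assumes "gt_R p m r s" "gt_R p m s t"
  shows "gt_R p m r t"
proof -
  have "rightmost_nonzero_neg (exp_diff p r t)"
    if rst: "rightmost_nonzero_neg (exp_diff p r s)" "rightmost_nonzero_neg (exp_diff p s t)"
  proof -
    obtain k where k: "k \<le> p" "Poly_Mapping.lookup r (var_at p k) < Poly_Mapping.lookup s (var_at p k)"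
        "\<forall>l. k < l \<and> l \<le> p \<longrightarrow> Poly_Mapping.lookup r (var_at p l) = Poly_Mapping.lookup s (var_at p l)"
      using rst(1) unfolding rightmost_exp_diff_iff by blast
    obtain k' where k': "k' \<le> p" "Poly_Mapping.lookup s (var_at p k') < Poly_Mapping.lookup t (var_at p k')"
        "\<forall>l. k' < l \<and> l \<le> p \<longrightarrow> Poly_Mapping.lookup s (var_at p l) = Poly_Mapping.lookup t (var_at p l)"
      using rst(2) unfolding rightmost_exp_diff_iff by blast
    \<comment> \<open>The larger of the two deciding positions decides between \<open>r\<close> and
      \<open>t\<close>.\<close>
    consider "k < k'" | "k = k'" | "k' < k" by linarith
    then have "Poly_Mapping.lookup r (var_at p (max k k')) < Poly_Mapping.lookup t (var_at p (max k k'))"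
      using k(1,2) k'(1,2) k(3)[rule_format, of k'] k'(3)[rule_format, of k] by cases (simp_all add: max_def)
    moreover have "\<forall>l. max k k' < l \<and> l \<le> p \<longrightarrow>
        Poly_Mapping.lookup r (var_at p l) = Poly_Mapping.lookup t (var_at p l)"
      using k(3) k'(3) by simp
    ultimately show ?thesis
      unfolding rightmost_exp_diff_iff using k(1) k'(1) by (intro exI[of _ "max k k'"]) simp
  qed
  then show ?thesis using assms by (auto simp: gt_R_def)
qed

lemma gt_R_total:
  assumes "Poly_Mapping.keys s \<subseteq> {0..p}" "Poly_Mapping.keys t \<subseteq> {0..p}" "s \<noteq> t"
  shows "gt_R p m s t \<or> gt_R p m t s"
proof -
  define D where "D = {k. k \<le> p \<and> Poly_Mapping.lookup s (var_at p k) \<noteq> Poly_Mapping.lookup t (var_at p k)}"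
  obtain i where i: "Poly_Mapping.lookup s i \<noteq> Poly_Mapping.lookup t i"
    using assms(3) unfolding poly_mapping_eq_iff fun_eq_iff by blast
  then have "i \<in> Poly_Mapping.keys s \<or> i \<in> Poly_Mapping.keys t" by (auto simp: in_keys_iff)
  then have "i \<le> p" using assms(1,2) by auto
  \<comment> \<open>The list position of the variable \<open>i\<close>: \<open>X 0\<close> stands
    last, at \<open>p\<close>.\<close>
  then have "(if i = 0 then p else i - 1) \<in> D" using i by (auto simp: D_def var_at_def)
  then have "Max D \<in> D" by (intro Max_in) (auto simp: D_def)
  have "\<forall>l. Max D < l \<and> l \<le> p \<longrightarrow>
      Poly_Mapping.lookup s (var_at p l) = Poly_Mapping.lookup t (var_at p l)"
  proof (intro allI impI, rule ccontr)
    fix l assume l: "Max D < l \<and> l \<le> p" "Poly_Mapping.lookup s (var_at p l) \<noteq> Poly_Mapping.lookup t (var_at p l)"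
    then have "l \<le> Max D" by (intro Max_ge) (auto simp: D_def)
    then show False using l by simp
  qed
  moreover have "Poly_Mapping.lookup s (var_at p (Max D)) < Poly_Mapping.lookup t (var_at p (Max D)) \<or>
      Poly_Mapping.lookup t (var_at p (Max D)) < Poly_Mapping.lookup s (var_at p (Max D))"
    using \<open>Max D \<in> D\<close> by (auto simp: D_def)
  moreover have "Max D \<le> p" using \<open>Max D \<in> D\<close> by (simp add: D_def)
  ultimately have "rightmost_nonzero_neg (exp_diff p s t) \<or> rightmost_nonzero_neg (exp_diff p t s)"
    unfolding rightmost_exp_diff_iff by metis
  then show ?thesis by (auto simp: gt_R_def)
qed

lemma weight_add: "weight p m (s + t) = weight p m s + weight p m t"
  by (simp add: weight_def lookup_add algebra_simps sum.distrib)

lemma weight_single: "i \<le> p \<Longrightarrow> weight p m (Poly_Mapping.single i k) = k * m i"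
  by (simp add: weight_def lookup_single when_def sum.delta if_distrib[of "\<lambda>x. x * _"] cong: if_cong)

lemma gt_R_add_iff: "gt_R p m (r + s) (r + t) \<longleftrightarrow> gt_R p m s t"
  by (simp add: gt_R_def weight_add rightmost_exp_diff_iff lookup_add)

lemma gt_R_add_left: "gt_R p m s t \<Longrightarrow> gt_R p m (r + s) (r + t)"
  by (simp add: gt_R_add_iff)

text \<open>\<open>X 0\<close> holds the last position, so at equal weight its exponent is compared
  first, and the larger exponent loses.\<close>

lemma gt_R_zeroI:
  assumes "weight p m s = weight p m t" "Poly_Mapping.lookup s 0 < Poly_Mapping.lookup t 0"
  shows "gt_R p m s t"
  using assms unfolding gt_R_def rightmost_exp_diff_iff
  by (intro disjI2 conjI exI[of _ p]) (auto simp: var_at_def)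

text \<open>\<open>X p\<close> stands at position \<open>p - 1\<close>, just before
  \<open>X 0\<close>, and is compared next.\<close>

lemma gt_R_lastI:
  assumes "p \<ge> 1" "weight p m s = weight p m t" "Poly_Mapping.lookup s 0 = Poly_Mapping.lookup t 0"
    "Poly_Mapping.lookup s p < Poly_Mapping.lookup t p"
  shows "gt_R p m s t"
  unfolding gt_R_def rightmost_exp_diff_iff
proof (intro disjI2 conjI exI[of _ "p - 1"] allI impI)
  fix l assume "p - 1 < l \<and> l \<le> p"
  then have "l = p" using assms(1) by linarith
  then show "Poly_Mapping.lookup s (var_at p l) = Poly_Mapping.lookup t (var_at p l)"
    using assms by (simp add: var_at_def)
qed (use assms in \<open>auto simp: var_at_def\<close>)

text \<open>Positive weights bound every exponent by \<open>w\<close>, and a monomial in the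
  variables up to \<open>p\<close> is determined by its list of exponents.\<close>

lemma finite_bounded_weight:
  assumes "\<And>i. i \<le> p \<Longrightarrow> 0 < m i"
  shows "finite {t. Poly_Mapping.keys t \<subseteq> {0..p} \<and> weight p m t \<le> w}" (is "finite ?T")
proof (rule inj_on_finite)
  let ?f = "\<lambda>t::mono. map (Poly_Mapping.lookup t) [0..<Suc p]"
  show "finite {xs. set xs \<subseteq> {..w} \<and> length xs = Suc p}"
    by (rule finite_lists_length_eq) simp
  show "inj_on ?f ?T"
  proof (rule inj_onI)
    fix s t assume st: "s \<in> ?T" "t \<in> ?T" "?f s = ?f t"
    show "s = t"
    proof (rule poly_mapping_eqI)
      fix i show "Poly_Mapping.lookup s i = Poly_Mapping.lookup t i"
      proof (cases "i \<le> p")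
        case True
        then show ?thesis using st(3) by (simp add: map_eq_conv del: upt_Suc)
      next
        case False
        then have "i \<notin> Poly_Mapping.keys s" "i \<notin> Poly_Mapping.keys t" using st(1,2) by auto
        then show ?thesis by (simp add: in_keys_iff)
      qed
    qed
  qed
  show "?f ` ?T \<subseteq> {xs. set xs \<subseteq> {..w} \<and> length xs = Suc p}"
  proof clarify
    fix t :: mono assume w: "weight p m t \<le> w"
    have "Poly_Mapping.lookup t i \<le> w" if "i \<le> p" for i
    proof -
      have "Poly_Mapping.lookup t i * 1 \<le> Poly_Mapping.lookup t i * m i"
        using assms[OF that] by (intro mult_le_mono) auto
      also have "\<dots> \<le> weight p m t"
        unfolding weight_def using that by (intro member_le_sum) auto
      finally show ?thesis using w by simp
    qed
    then show "set (?f t) \<subseteq> {..w} \<and> length (?f t) = Suc p" by auto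
  qed
qed

lemma gt_sym_irrefl: "\<not> gt_sym e e"
  by (cases e) auto

lemma gt_sym_trans: "gt_sym e f \<Longrightarrow> gt_sym f g \<Longrightarrow> gt_sym e g"
  by (cases e; cases f; cases g) auto

lemma gt_sym_total: "e \<noteq> f \<Longrightarrow> gt_sym e f \<or> gt_sym f e"
  by (cases e; cases f) auto

lemma finite_basis_syms: "finite (basis_syms p b)"
proof -
  have "basis_syms p b \<subseteq> Psi ` {..p - b} \<union> case_prod Phi ` ({..p} \<times> {..p})"
    by (force simp: basis_syms_def)
  then show ?thesis by (rule finite_subset) auto
qed

text \<open>\<open>m 0 = a * p + b\<close> and \<open>m i = m 0 + i * d\<close> are merged into one
  formula, so that weight comparisons become arithmetic in \<open>a\<close>, \<open>b\<close>,
  \<open>d\<close> and \<open>p\<close>.\<close>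

locale syzygy_setting =
  fixes p d a b :: nat and m :: "nat \<Rightarrow> nat"
  assumes p: "2 \<le> p" and a: "1 \<le> a" and b: "1 \<le> b" "b \<le> p"
    and m: "\<And>i. i \<le> p \<Longrightarrow> m i = a * p + b + i * d"
begin

abbreviation gtR :: "mono \<Rightarrow> mono \<Rightarrow> bool" where "gtR \<equiv> gt_R p m"
abbreviation gtM :: "mono \<times> sym \<Rightarrow> mono \<times> sym \<Rightarrow> bool" where "gtM \<equiv> gt_M p a b m"
abbreviation syms :: "sym set" where "syms \<equiv> basis_syms p b"

lemma varpi_keys:
  assumes "u \<in> mons p syms"
  shows "Poly_Mapping.keys (varpi p a b u) \<subseteq> {0..p}"
proof -
  obtain t e where u: "u = (t, e)" "Poly_Mapping.keys t \<subseteq> {0..p}" "e \<in> syms"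
    using assms by (auto simp: mons_def)
  have "Poly_Mapping.keys (varpi_sym p a b e) \<subseteq> {0..p}"
    using u(3) b p by (cases e) (auto simp: basis_syms_def in_keys_iff lookup_add lookup_single when_def split: if_splits)
  then show ?thesis
    using u(2) keys_add[of t "varpi_sym p a b e"] by (auto simp: varpi_def u(1))
qed

sublocale module_order p syms gtM
proof
  show "\<not> gtM u u" for u
    by (simp add: gt_M_def gt_R_irrefl gt_sym_irrefl)
  show "gtM u w" if "gtM u v" "gtM v w" for u v w
    using that gt_R_trans[of p m "varpi p a b u" "varpi p a b v" "varpi p a b w"]
      gt_sym_trans[of "snd u" "snd v" "snd w"] by (auto simp: gt_M_def)
  show "gtM u w \<or> gtM w u" if uw: "u \<in> mons p syms" "w \<in> mons p syms" "u \<noteq> w" for u w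
  proof (cases "varpi p a b u = varpi p a b w")
    case True
    \<comment> \<open>Over a fixed symbol \<open>varpi\<close> is a translation, so equal values at
      distinct arguments force distinct symbols.\<close>
    then have "snd u \<noteq> snd w" using uw(3) by (cases u; cases w) (auto simp: varpi_def)
    then show ?thesis using True gt_sym_total by (auto simp: gt_M_def)
  next
    case False
    then show ?thesis
      using gt_R_total[OF varpi_keys[OF uw(1)] varpi_keys[OF uw(2)]] by (auto simp: gt_M_def)
  qed
  show "gtM (r + s, e) (r + t, f)" if "gtM (s, e) (t, f)" for r s e t f
    using that by (auto simp: gt_M_def varpi_def add.assoc gt_R_add_iff)
  show "finite {w \<in> mons p syms. gtM u w}" for u
  proof (rule finite_subset)
    \<comment> \<open>Passing to \<open>varpi\<close> cannot lower the weight, so everything below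
      \<open>u\<close> has weight at most that of \<open>varpi u\<close>; there are finitely many
      such monomials and finitely many symbols.\<close>
    let ?T = "{t. Poly_Mapping.keys t \<subseteq> {0..p} \<and> weight p m t \<le> weight p m (varpi p a b u)}"
    show "{w \<in> mons p syms. gtM u w} \<subseteq> ?T \<times> syms"
    proof
      fix w assume w: "w \<in> {w \<in> mons p syms. gtM u w}"
      have "weight p m (fst w) \<le> weight p m (varpi p a b w)" by (simp add: varpi_def weight_add)
      also have "\<dots> \<le> weight p m (varpi p a b u)" using w by (auto simp: gt_M_def gt_R_def)
      finally show "w \<in> ?T \<times> syms" using w by (cases w) (simp add: mons_def)
    qed
    show "finite (?T \<times> syms)"
      using m b by (intro finite_cartesian_product finite_bounded_weight finite_basis_syms) simp
  qed
qed

end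

section \<open>The syzygies and their leading monomials\<close>

definition var :: "nat \<Rightarrow> mono" where
  "var i = Poly_Mapping.single i 1"

lemma lookup_var: "Poly_Mapping.lookup (var i) k = (if i = k then 1 else 0)"
  by (simp add: var_def lookup_single when_def)

lemma X_eq_single: "X i = Poly_Mapping.single (var i) 1"
  by (simp add: X_def var_def)

lemma single_var_power: "Poly_Mapping.single (var i) 1 ^ n = (Poly_Mapping.single (Poly_Mapping.single i n) 1 :: 'k::field mpoly)"
  by (induction n) (simp_all add: var_def mult_single flip: single_add)

lemma weight_var: "i \<le> p \<Longrightarrow> weight p m (var i) = m i"
  by (simp add: var_def weight_single)

lemma vPhi_commute: "vPhi p i j = vPhi p j i"
  by (simp add: vPhi_def min.commute max.commute conj_commute)

text \<open>\<open>G_hat\<close> takes \<open>syzB\<close> over ordered pairs, and swapping the pair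
  keeps the leading monomial; minimality holds because the element is the same too.\<close>

lemma syzB_commute: "syzB p a d b i j = syzB p a d b j i"
  by (simp add: syzB_def vPhi_commute[of p i j] eps_def add.commute mult.commute)

text \<open>The common second term of all \<open>phi p i j\<close> with \<open>i + j = s\<close>.\<close>

definition nf_mono :: "nat \<Rightarrow> nat \<Rightarrow> mono" where
  "nf_mono p s = (if s < p then var s + var 0 else var p + var (s - p))"

lemma nf_mono_eps: "nf_mono p (i + j) = var (eps p i j) + var (i + j - eps p i j)"
  by (simp add: nf_mono_def eps_def)

text \<open>\<open>eps\<close> and \<open>tau\<close> name factors of the same product: for
  \<open>i + j < p\<close> they pick \<open>i + j\<close> and \<open>0\<close>, otherwise both pick
  \<open>p\<close>.\<close>

lemma nf_mono_tau: "nf_mono p (i + j) = var (tau p i j) + var (i + j - tau p i j)"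
  by (simp add: nf_mono_def tau_def add.commute)

lemma phi_eq: "phi p i j = Poly_Mapping.single (var i + var j) 1 - Poly_Mapping.single (nf_mono p (i + j)) 1"
  by (simp add: phi_def X_eq_single mult_single nf_mono_eps)

text \<open>The subtracted monomial of each binomial generator, arranged by symbol to parallel
  \<open>varpi_sym\<close>.\<close>

primrec tail_mono :: "nat \<Rightarrow> nat \<Rightarrow> nat \<Rightarrow> sym \<Rightarrow> mono" where
  "tail_mono p a d (Psi i) = var i + Poly_Mapping.single 0 (a + d)"
| "tail_mono p a d (Phi i j) = nf_mono p (i + j)"

lemma varpi_sym_Psi: "varpi_sym p a b (Psi i) = Poly_Mapping.single p a + var (b + i)"
  and varpi_sym_Phi: "varpi_sym p a b (Phi i j) = var i + var j"
  by (simp_all add: var_def)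

lemma gen_poly_eq:
  "gen_poly p a d b e = Poly_Mapping.single (varpi_sym p a b e) 1 - Poly_Mapping.single (tail_mono p a d e) 1"
  by (cases e)
     (simp_all add: phi_eq psi_def single_var_power X_eq_single mult_single varpi_sym_Psi varpi_sym_Phi
       add.commute del: varpi_sym.simps)

context syzygy_setting
begin

text \<open>\<open>m\<close> is affine in the index, so the weight of a product of two variables
  depends only on the index sum, which \<open>nf_mono\<close> preserves.\<close>

lemma weight_nf_mono: "i \<le> p \<Longrightarrow> j \<le> p \<Longrightarrow> weight p m (nf_mono p (i + j)) = m i + m j"
proof -
  assume ij: "i \<le> p" "j \<le> p"
  show ?thesis
  proof (cases "i + j < p")
    case False
    then have "p * d + (i + j - p) * d = i * d + j * d"
      by (simp flip: add_mult_distrib)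
    then show ?thesis using ij False by (simp add: nf_mono_def weight_add weight_var m)
  qed (use ij in \<open>simp add: nf_mono_def weight_add weight_var m algebra_simps\<close>)
qed

text \<open>If \<open>i + j\<close> is at most \<open>p\<close>, only the second monomial contains
  \<open>X 0\<close>; beyond \<open>p\<close> neither does, and only the second contains
  \<open>X p\<close>.\<close>

lemma phi_order:
  assumes "1 \<le> i" "i < p" "1 \<le> j" "j < p"
  shows "gtR (var i + var j) (nf_mono p (i + j))"
proof -
  have w: "weight p m (var i + var j) = weight p m (nf_mono p (i + j))"
    using assms by (simp add: weight_nf_mono weight_add weight_var)
  show ?thesis
  proof (cases "i + j \<le> p")
    case True
    then show ?thesis
      using assms p by (intro gt_R_zeroI w) (auto simp: lookup_add lookup_var nf_mono_def)
  next
    case False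
    then show ?thesis
      using assms p by (intro gt_R_lastI w) (auto simp: lookup_add lookup_var nf_mono_def)
  qed
qed

text \<open>The weights agree because \<open>a * p * d + b * d = d * m 0\<close>, and only the
  second monomial contains \<open>X 0\<close>.\<close>

lemma psi_order:
  assumes "j \<le> p - b"
  shows "gtR (Poly_Mapping.single p a + var (b + j)) (var j + Poly_Mapping.single 0 (a + d))"
proof (rule gt_R_zeroI)
  have "b + j \<le> p" "j \<le> p" using assms b by auto
  then show "weight p m (Poly_Mapping.single p a + var (b + j)) =
      weight p m (var j + Poly_Mapping.single 0 (a + d))"
    by (simp add: weight_add weight_var weight_single m algebra_simps)
qed (use a b p in \<open>auto simp: lookup_add lookup_var lookup_single when_def\<close>)

lemma tail_mono_order:
  assumes "e \<in> syms"
  shows "gtR (varpi_sym p a b e) (tail_mono p a d e)"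
  using assms phi_order psi_order
  by (cases e) (auto simp: basis_syms_def varpi_sym_Psi varpi_sym_Phi simp del: varpi_sym.simps)

section \<open>The elements of \<open>G_hat\<close> are syzygies\<close>

abbreviation syz_module :: "(sym, 'k::field) vec set" where
  "syz_module \<equiv> first_syzygy_module p a d b"

lemma free_module_vPsi: "j \<le> p - b \<Longrightarrow> vPsi j \<in> free_module p syms"
  by (intro free_module_unit_vec) (simp add: basis_syms_def)

lemma free_module_vPhi: "vPhi p i j \<in> free_module p syms"
  by (auto simp: vPhi_def basis_syms_def min_def max_def intro!: free_module_unit_vec free_module_zero)

text \<open>The convention \<open>\<Phi>(i,j) = 0\<close> for \<open>i \<in> {0,p}\<close> is consistent since \<open>phi p i j = 0\<close> there.\<close>

lemma lin_ext_vPhi: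
  assumes "i \<le> p" "j \<le> p"
  shows "lin_ext (gen_poly p a d b) (vPhi p i j) = phi p i j"
proof (cases "i \<in> {1..p - 1} \<and> j \<in> {1..p - 1}")
  case True
  then show ?thesis
    by (simp add: vPhi_def phi_eq min_def max_def add.commute)
next
  case False
  then have "i = 0 \<or> i = p \<or> j = 0 \<or> j = p" using assms by auto
  then have "phi p i j = (0 :: 'a mpoly)"
    using assms p by (auto simp: phi_def eps_def mult.commute)
  then show ?thesis using False by (auto simp: vPhi_def)
qed

text \<open>The products with \<open>X p ^ a\<close> cancel against \<open>phi p i (b + j)\<close>,
  those with \<open>X 0 ^ (a + d)\<close> against the values of the two last terms.\<close>

lemma syzA_mem:
  assumes "i \<le> p" "j < p - b"
  shows "syzA p a d b i j \<in> syz_module"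
proof -
  have e: "b \<le> eps p i (b + j)" "eps p i (b + j) \<le> p" using b by (auto simp: eps_def)
  have "syzA p a d b i j \<in> free_module p syms"
    unfolding syzA_def using assms e
    by (intro free_module_add free_module_diff free_module_smul free_module_vPsi free_module_vPhi
        polys_X polys_power) (auto simp: eps_def)
  moreover have "lin_ext (gen_poly p a d b) (syzA p a d b i j) = 0"
  proof (cases "b + i + j < p")
    case True
    \<comment> \<open>Here the truncated index \<open>b + i + j - p\<close> is 0, so the last term
      has value 0.\<close>
    then have "eps p i (b + j) = b + i + j" "eps p i j = i + j" "eps p 0 (p - b) = p - b"
      using b by (auto simp: eps_def)
    then show ?thesis
      using assms True
      by (simp add: syzA_def lin_ext_add lin_ext_diff lin_ext_smul lin_ext_vPhi phi_def psi_def algebra_simps)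
  next
    case False
    \<comment> \<open>The two last terms now have the same index sum \<open>i + j\<close>, so their
      values share the second monomial, which cancels.\<close>
    then have "eps p i (b + j) = p" "eps p (b + i + j - p) (p - b) = eps p i j"
        "b + i + j - p + (p - b) = i + j"
      using b assms by (auto simp: eps_def)
    then show ?thesis
      using assms False b
      by (simp add: syzA_def lin_ext_add lin_ext_diff lin_ext_smul lin_ext_vPhi phi_def psi_def algebra_simps)
  qed
  ultimately show ?thesis by (simp add: first_syzygy_module_def syzygies_iff)
qed

lemma polys_psi: "j \<le> p - b \<Longrightarrow> psi p a d b j \<in> polys p"
  unfolding psi_def using b by (intro polys_diff polys_mult polys_power polys_X) auto

text \<open>The Koszul relation between \<open>psi p a d b (p - b)\<close> and
  \<open>phi p i j\<close>.\<close>

lemma syzB_mem: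
  assumes "i \<le> p" "j \<le> p"
  shows "syzB p a d b i j \<in> syz_module"
proof -
  have "syzB p a d b i j \<in> free_module p syms"
    unfolding syzB_def using assms
    by (intro free_module_add free_module_diff free_module_smul free_module_vPsi free_module_vPhi
        polys_X polys_mult polys_psi) (auto simp: eps_def)
  moreover have "lin_ext (gen_poly p a d b) (syzB p a d b i j) = 0"
    unfolding syzB_def lin_ext_diff lin_ext_smul lin_ext_unit_vec gen_poly.simps lin_ext_vPhi[OF assms] phi_def
    by (simp add: algebra_simps)
  ultimately show ?thesis by (simp add: first_syzygy_module_def syzygies_iff)
qed

lemma syzL_mem:
  assumes "l \<in> {1..p - 1}" "i \<in> {1..p - 1}" "j \<in> {1..p - 1}"
  shows "syzL p l i j \<in> syz_module"
proof -
  have t: "l \<le> p" "i \<le> p" "j \<le> p" "i + j - tau p i j \<le> p" "i + l - tau p i l \<le> p" "tau p i j \<le> p" "tau p i l \<le> p"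
    using assms by (auto simp: tau_def)
  have "syzL p l i j \<in> free_module p syms"
    unfolding syzL_def using assms t
    by (intro free_module_add free_module_diff free_module_smul free_module_vPhi polys_X) auto
  moreover have "lin_ext (gen_poly p a d b) (syzL p l i j) = 0"
  proof -
    \<comment> \<open>Both sides depend only on the index sum \<open>l + i + j\<close>, through its
      position relative to \<open>p\<close> and \<open>2 * p\<close>.\<close>
    have "var (tau p i j) + nf_mono p (i + j - tau p i j + l) =
        var (tau p i l) + nf_mono p (i + l - tau p i l + j)"
      using assms by (auto simp: tau_def nf_mono_def algebra_simps)
    \<comment> \<open>The second monomials from the first two terms cancel against the first
      monomials from the last two.\<close>
    moreover have "var (tau p i j) + (var (i + j - tau p i j) + var l) = var l + nf_mono p (i + j)"
        "var (tau p i l) + (var (i + l - tau p i l) + var j) = var j + nf_mono p (i + l)"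
      by (simp_all add: nf_mono_tau add.assoc add.left_commute add.commute)
    moreover have "var l + (var i + var j) = var j + (var i + var l)"
      by (simp add: add.left_commute add.commute)
    ultimately show ?thesis
      using t
      by (simp add: syzL_def lin_ext_add lin_ext_diff lin_ext_smul lin_ext_vPhi phi_eq X_eq_single
          right_diff_distrib mult_single)
  qed
  ultimately show ?thesis by (simp add: first_syzygy_module_def syzygies_iff)
qed

section \<open>Leading monomials of the three families\<close>

lemma below_vPsi:
  assumes "gtR (varpi p a b u) (t + (Poly_Mapping.single p a + var (b + j))) \<or>
    varpi p a b u = t + (Poly_Mapping.single p a + var (b + j)) \<and> gt_sym (snd u) (Psi j)"
  shows "below u (Poly_Mapping.single t 1 \<odot> vPsi j)"
proof -
  have "gtM u (t, Psi j)" using assms by (simp add: gt_M_def varpi_def var_def)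
  from below_mterm[OF this] show ?thesis by (simp add: mterm_def smul_unit_vec)
qed

text \<open>The bound is asked only for indices in range, since otherwise \<open>vPhi\<close> is
  0.\<close>

lemma below_vPhi:
  assumes "i \<in> {1..p - 1} \<Longrightarrow> j \<in> {1..p - 1} \<Longrightarrow> gtR (varpi p a b u) (t + (var i + var j)) \<or>
    varpi p a b u = t + (var i + var j) \<and> gt_sym (snd u) (Phi (min i j) (max i j))"
  shows "below u (Poly_Mapping.single t 1 \<odot> vPhi p i j)"
proof (cases "i \<in> {1..p - 1} \<and> j \<in> {1..p - 1}")
  case True
  have "var (min i j) + var (max i j) = var i + var j" by (simp add: min_def max_def add.commute)
  then have "gtM u (t, Phi (min i j) (max i j))"
    using assms True by (simp add: gt_M_def varpi_def var_def)
  from below_mterm[OF this] show ?thesis using True by (simp add: mterm_def smul_unit_vec vPhi_def)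
next
  case False
  then show ?thesis by (auto simp: vPhi_def)
qed

lemma lead_syzA:
  assumes i: "1 \<le> i" "i \<le> p" and j: "j < p - b"
  shows "lead_mon gtM (syzA p a d b i j :: (sym, 'k::field) vec) = (var i, Psi j)"
    and "lead_coef gtM (syzA p a d b i j :: (sym, 'k) vec) = 1"
proof -
  let ?u = "(var i, Psi j)"
  let ?r = "eps p i (b + j)"
  let ?k = "b + i + j - p"
  define rest where "rest = (0 - Poly_Mapping.single (var (b + i + j - ?r)) 1 \<odot> vPsi (?r - b)
     - Poly_Mapping.single (Poly_Mapping.single p a) 1 \<odot> vPhi p i (b + j)
     + (Poly_Mapping.single (Poly_Mapping.single 0 (a + d)) 1 \<odot> vPhi p i j
        - Poly_Mapping.single (Poly_Mapping.single 0 (a + d)) 1 \<odot> vPhi p ?k (p - b)) :: (sym, 'k) vec)"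
  have eq: "syzA p a d b i j = mterm 1 ?u + rest"
    by (simp add: syzA_def rest_def mterm_def smul_unit_vec single_var_power X_eq_single smul_diff_right)
  have vu: "varpi p a b ?u = var i + (Poly_Mapping.single p a + var (b + j))"
    by (simp add: varpi_def varpi_sym_Psi del: varpi_sym.simps)
  have bj: "1 \<le> b + j" "b + j < p" using j b by auto
  have phi: "gtR (Poly_Mapping.single p a + (var i + var (b + j))) (Poly_Mapping.single p a + nf_mono p (i + (b + j)))"
    if "i < p"
    using phi_order[of i "b + j"] i bj that by (intro gt_R_add_left) simp
  have nf_p: "nf_mono p (p + (b + j)) = var p + var (b + j)"
    by (simp add: nf_mono_def)
  have rb: "b + (?r - b) = ?r" using b by (auto simp: eps_def)
  have psi: "below ?u (Poly_Mapping.single (var (b + i + j - ?r)) 1 \<odot> (vPsi (?r - b) :: (sym, 'k) vec))"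
  proof (rule below_vPsi)
    have *: "var (b + i + j - ?r) + (Poly_Mapping.single p a + var (b + (?r - b))) =
        Poly_Mapping.single p a + nf_mono p (i + (b + j))"
      unfolding nf_mono_eps rb by (simp add: add_ac)
    show "gtR (varpi p a b ?u) (var (b + i + j - ?r) + (Poly_Mapping.single p a + var (b + (?r - b)))) \<or>
      varpi p a b ?u = var (b + i + j - ?r) + (Poly_Mapping.single p a + var (b + (?r - b))) \<and>
        gt_sym (snd ?u) (Psi (?r - b))"
    proof (cases "i = p")
      case True
      \<comment> \<open>For \<open>i = p\<close> the second term has the same \<open>varpi\<close>
        as the first; the tie goes to the smaller index \<open>j < p - b\<close>.\<close>
      then have nf: "nf_mono p (i + (b + j)) = var p + var (b + j)" using nf_p by simp
      show ?thesis unfolding * vu nf using True j b by (auto simp: add_ac eps_def)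
    next
      case False
      then show ?thesis unfolding * vu using phi i by (simp add: add_ac)
    qed
  qed
  \<comment> \<open>Equal \<open>varpi\<close>: the tie is settled by \<open>Psi\<close> ranking
    above \<open>Phi\<close>.\<close>
  have phi1: "below ?u (Poly_Mapping.single (Poly_Mapping.single p a) 1 \<odot> (vPhi p i (b + j) :: (sym, 'k) vec))"
    by (rule below_vPhi) (simp add: vu add_ac)
  have phi2: "below ?u (Poly_Mapping.single (Poly_Mapping.single 0 (a + d)) 1 \<odot> (vPhi p i j :: (sym, 'k) vec))"
  proof (rule below_vPhi, rule disjI1)
    show "gtR (varpi p a b ?u) (Poly_Mapping.single 0 (a + d) + (var i + var j))"
      unfolding vu using gt_R_add_left[OF psi_order[of j], of "var i"] j by (simp add: add_ac)
  qed
  have phi3: "below ?u (Poly_Mapping.single (Poly_Mapping.single 0 (a + d)) 1 \<odot> (vPhi p ?k (p - b) :: (sym, 'k) vec))"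
  proof (rule below_vPhi, rule disjI1)
    assume k: "?k \<in> {1..p - 1}"
    then have nf: "nf_mono p (i + (b + j)) = var p + var ?k" by (auto simp: nf_mono_def add_ac)
    \<comment> \<open>The chain passes through \<open>X p ^ (a + 1) * X ?k\<close>:
      \<open>phi_order\<close> leads down to it (with equality for \<open>i = p\<close>), and
      \<open>psi_order\<close> at index \<open>p - b\<close> leads further down.\<close>
    have "gtR (var ?k + (Poly_Mapping.single p a + var (b + (p - b)))) (var ?k + (var (p - b) + Poly_Mapping.single 0 (a + d)))"
      by (intro gt_R_add_left psi_order) simp
    then have lt: "gtR (Poly_Mapping.single p a + nf_mono p (i + (b + j))) (Poly_Mapping.single 0 (a + d) + (var ?k + var (p - b)))"
      using b unfolding nf by (simp add: add_ac)
    show "gtR (varpi p a b ?u) (Poly_Mapping.single 0 (a + d) + (var ?k + var (p - b)))"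
    proof (cases "i = p")
      case True
      then show ?thesis unfolding vu using lt nf_p by (simp add: add_ac)
    next
      case False
      then show ?thesis
        unfolding vu using gt_R_trans[OF phi lt] i by (simp add: add_ac)
    qed
  qed
  have "below ?u rest"
    unfolding rest_def using psi phi1 phi2 phi3 by (intro below_add below_diff below_zero)
  then show "lead_mon gtM (syzA p a d b i j :: (sym, 'k) vec) = (var i, Psi j)" "lead_coef gtM (syzA p a d b i j :: (sym, 'k) vec) = 1"
    unfolding eq by (rule lead_monomial_below)+
qed

lemma lead_syzB:
  assumes i: "i \<in> {1..p - 1}" and j: "j \<in> {1..p - 1}"
  shows "lead_mon gtM (syzB p a d b i j :: (sym, 'k::field) vec) = (var i + var j, Psi (p - b))"
    and "lead_coef gtM (syzB p a d b i j :: (sym, 'k) vec) = 1"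
proof -
  let ?u = "(var i + var j, Psi (p - b))"
  have ij: "1 \<le> i" "i < p" "1 \<le> j" "j < p" using i j p by auto
  define rest where "rest = (0 - Poly_Mapping.single (nf_mono p (i + j)) 1 \<odot> vPsi (p - b)
     - (Poly_Mapping.single (varpi_sym p a b (Psi (p - b))) 1 \<odot> vPhi p i j
        - Poly_Mapping.single (tail_mono p a d (Psi (p - b))) 1 \<odot> vPhi p i j) :: (sym, 'k) vec)"
  have psi: "psi p a d b (p - b) = Poly_Mapping.single (varpi_sym p a b (Psi (p - b))) 1 -
      (Poly_Mapping.single (tail_mono p a d (Psi (p - b))) 1 :: 'k mpoly)"
    by (simp only: gen_poly_eq flip: gen_poly.simps)
  have eq: "syzB p a d b i j = mterm 1 ?u + rest"
    unfolding syzB_def psi smul_diff_left rest_def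
    by (simp add: mterm_def smul_unit_vec X_eq_single mult_single nf_mono_eps)
  have vu: "varpi p a b ?u = var i + var j + varpi_sym p a b (Psi (p - b))"
    by (simp add: varpi_def)
  have 1: "below ?u (Poly_Mapping.single (nf_mono p (i + j)) 1 \<odot> (vPsi (p - b) :: (sym, 'k) vec))"
  proof (rule below_vPsi, rule disjI1)
    show "gtR (varpi p a b ?u) (nf_mono p (i + j) + (Poly_Mapping.single p a + var (b + (p - b))))"
      using gt_R_add_left[OF phi_order[OF ij], of "varpi_sym p a b (Psi (p - b))"]
      by (simp add: vu varpi_sym_Psi add_ac del: varpi_sym.simps)
  qed
  \<comment> \<open>Another tie in \<open>varpi\<close> that goes to \<open>Psi\<close>.\<close>
  have 2: "below ?u (Poly_Mapping.single (varpi_sym p a b (Psi (p - b))) 1 \<odot> (vPhi p i j :: (sym, 'k) vec))"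
    by (rule below_vPhi) (simp add: vu add_ac del: varpi_sym.simps)
  have 3: "below ?u (Poly_Mapping.single (tail_mono p a d (Psi (p - b))) 1 \<odot> (vPhi p i j :: (sym, 'k) vec))"
  proof (rule below_vPhi, rule disjI1)
    have "Psi (p - b) \<in> syms" by (simp add: basis_syms_def)
    from gt_R_add_left[OF tail_mono_order[OF this], of "var i + var j"]
    show "gtR (varpi p a b ?u) (tail_mono p a d (Psi (p - b)) + (var i + var j))"
      by (simp add: vu add_ac del: varpi_sym.simps tail_mono.simps)
  qed
  have "below ?u rest"
    unfolding rest_def using 1 2 3 by (intro below_diff below_zero)
  then show "lead_mon gtM (syzB p a d b i j :: (sym, 'k) vec) = ?u" "lead_coef gtM (syzB p a d b i j :: (sym, 'k) vec) = 1"
    unfolding eq by (rule lead_monomial_below)+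
qed

lemma lead_syzL:
  assumes l: "l \<in> {1..p - 1}" and i: "i \<in> {1..p - 1}" and j: "j \<in> {1..p - 1}" and "i \<le> j" "l < j"
  shows "lead_mon gtM (syzL p l i j :: (sym, 'k::field) vec) = (var l, Phi i j)"
    and "lead_coef gtM (syzL p l i j :: (sym, 'k) vec) = 1"
proof -
  let ?u = "(var l, Phi i j)"
  have lij: "1 \<le> l" "l < p" "1 \<le> i" "i < p" "1 \<le> j" "j < p" using l i j p by auto
  define rest where "rest = (0 - Poly_Mapping.single (var j) 1 \<odot> vPhi p i l
     + Poly_Mapping.single (var (tau p i j)) 1 \<odot> vPhi p (i + j - tau p i j) l
     - Poly_Mapping.single (var (tau p i l)) 1 \<odot> vPhi p (i + l - tau p i l) j :: (sym, 'k) vec)"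
  have eq: "syzL p l i j = mterm 1 ?u + rest"
    using assms by (simp add: syzL_def rest_def mterm_def vPhi_def[of p i j] smul_unit_vec X_eq_single
        min_absorb1 max_absorb2)
  have vu: "varpi p a b ?u = var l + (var i + var j)"
    by (simp add: varpi_def var_def)
  \<comment> \<open>A tie in \<open>varpi\<close> again: since \<open>l < j\<close>, the symbol
    \<open>Phi i j\<close> wins by its second index if \<open>i < j\<close> and by its first if
    \<open>i = j\<close>.\<close>
  have 1: "below ?u (Poly_Mapping.single (var j) 1 \<odot> (vPhi p i l :: (sym, 'k) vec))"
    by (rule below_vPhi) (use assms in \<open>auto simp: vu add_ac min_def max_def\<close>)
  have 2: "below ?u (Poly_Mapping.single (var (tau p i j)) 1 \<odot> (vPhi p (i + j - tau p i j) l :: (sym, 'k) vec))"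
  proof (rule below_vPhi, rule disjI1)
    show "gtR (varpi p a b ?u) (var (tau p i j) + (var (i + j - tau p i j) + var l))"
      using gt_R_add_left[OF phi_order[OF lij(3-6)], of "var l"] by (simp add: vu nf_mono_tau add_ac)
  qed
  have 3: "below ?u (Poly_Mapping.single (var (tau p i l)) 1 \<odot> (vPhi p (i + l - tau p i l) j :: (sym, 'k) vec))"
  proof (rule below_vPhi, rule disjI1)
    show "gtR (varpi p a b ?u) (var (tau p i l) + (var (i + l - tau p i l) + var j))"
      using gt_R_add_left[OF phi_order[OF lij(3,4,1,2)], of "var j"] by (simp add: vu nf_mono_tau add_ac)
  qed
  have "below ?u rest"
    unfolding rest_def using 1 2 3 by (intro below_add below_diff below_zero)
  then show "lead_mon gtM (syzL p l i j :: (sym, 'k) vec) = ?u" "lead_coef gtM (syzL p l i j :: (sym, 'k) vec) = 1"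
    unfolding eq by (rule lead_monomial_below)+
qed

text \<open>Free of the coefficient field, unlike \<open>G_hat\<close>, so that the study of
  standard monomials is purely combinatorial.\<close>

definition lead_set :: "(mono \<times> sym) set" where
  "lead_set = {(var i, Psi j) | i j. i \<in> {1..p} \<and> j < p - b}
     \<union> {(var i + var j, Psi (p - b)) | i j. i \<in> {1..p - 1} \<and> j \<in> {1..p - 1}}
     \<union> {(var l, Phi i j) | l i j. l \<in> {1..p - 1} \<and> i \<in> {1..p - 1} \<and> j \<in> {1..p - 1} \<and> i \<le> j \<and> l < j}"

abbreviation G :: "(sym, 'k::field) vec set" where
  "G \<equiv> G_hat p a d b"

lemma G_hat_cases:
  assumes "g \<in> (G :: (sym, 'k::field) vec set)"
  obtains (A) i j where "i \<in> {1..p}" "j < p - b" "g = syzA p a d b i j" "lead_mon gtM g = (var i, Psi j)"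
      "lead_coef gtM g = 1"
    | (B) i j where "i \<in> {1..p - 1}" "j \<in> {1..p - 1}" "g = syzB p a d b i j"
      "lead_mon gtM g = (var i + var j, Psi (p - b))" "lead_coef gtM g = 1"
    | (L) l i j where "l \<in> {1..p - 1}" "i \<in> {1..p - 1}" "j \<in> {1..p - 1}" "i \<le> j" "l < j"
      "g = syzL p l i j" "lead_mon gtM g = (var l, Phi i j)" "lead_coef gtM g = 1"
proof -
  from assms consider
      (1) i j where "i \<in> {1..p}" "j < p - b" "g = syzA p a d b i j"
    | (2) i j where "i \<in> {1..p - 1}" "j \<in> {1..p - 1}" "g = syzB p a d b i j"
    | (3) l i j where "l \<in> {1..p - 1}" "i \<in> {1..p - 1}" "j \<in> {1..p - 1}" "i \<le> j" "l < j"
      "g = syzL p l i j"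
    unfolding G_hat_def by blast
  then show ?thesis
  proof cases
    case 1
    then show ?thesis using A[OF 1] lead_syzA[of i j, where 'k = 'k] by simp
  next
    case 2
    then show ?thesis using B[OF 2] lead_syzB[of i j, where 'k = 'k] by simp
  next
    case 3
    then show ?thesis using L[OF 3] lead_syzL[of l i j, where 'k = 'k] by simp
  qed
qed

lemma lead_set_eq: "lead_mon gtM ` (G :: (sym, 'k::field) vec set) = lead_set"
proof
  show "lead_mon gtM ` (G :: (sym, 'k) vec set) \<subseteq> lead_set"
  proof
    fix u assume "u \<in> lead_mon gtM ` (G :: (sym, 'k) vec set)"
    then obtain g :: "(sym, 'k) vec" where g: "g \<in> G" "u = lead_mon gtM g" by blast
    show "u \<in> lead_set"
      using g(1) by (cases rule: G_hat_cases) (auto simp: lead_set_def g(2))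
  qed
  show "lead_set \<subseteq> lead_mon gtM ` (G :: (sym, 'k) vec set)"
  proof
    fix u assume "u \<in> lead_set"
    then consider
        (1) i j where "i \<in> {1..p}" "j < p - b" "u = (var i, Psi j)"
      | (2) i j where "i \<in> {1..p - 1}" "j \<in> {1..p - 1}" "u = (var i + var j, Psi (p - b))"
      | (3) l i j where "l \<in> {1..p - 1}" "i \<in> {1..p - 1}" "j \<in> {1..p - 1}" "i \<le> j" "l < j"
        "u = (var l, Phi i j)"
      unfolding lead_set_def by blast
    then show "u \<in> lead_mon gtM ` (G :: (sym, 'k) vec set)"
    proof cases
      case 1
      then have "syzA p a d b i j \<in> (G :: (sym, 'k) vec set)" unfolding G_hat_def by blast
      then show ?thesis
        using 1 lead_syzA(1)[of i j, where 'k = 'k] by (intro image_eqI) auto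
    next
      case 2
      then have "syzB p a d b i j \<in> (G :: (sym, 'k) vec set)" unfolding G_hat_def by blast
      then show ?thesis
        using 2 lead_syzB(1)[of i j, where 'k = 'k] by (intro image_eqI) auto
    next
      case 3
      then have "syzL p l i j \<in> (G :: (sym, 'k) vec set)" unfolding G_hat_def by blast
      then show ?thesis
        using 3 lead_syzL(1)[of l i j, where 'k = 'k] by (intro image_eqI) auto
    qed
  qed
qed

lemma finite_G_hat: "finite (G :: (sym, 'k::field) vec set)"
proof -
  have "(G :: (sym, 'k) vec set) \<subseteq>
      (\<lambda>(i, j). syzA p a d b i j) ` ({..p} \<times> {..p}) \<union> (\<lambda>(i, j). syzB p a d b i j) ` ({..p} \<times> {..p}) \<union>
      (\<lambda>(l, i, j). syzL p l i j) ` ({..p} \<times> {..p} \<times> {..p})"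
    (is "_ \<subseteq> ?S")
  proof
    fix g :: "(sym, 'k) vec" assume "g \<in> G"
    then show "g \<in> ?S"
    proof (cases rule: G_hat_cases)
      case (A i j)
      then have "(i, j) \<in> {..p} \<times> {..p}" by auto
      then show ?thesis using A(3) by blast
    next
      case (B i j)
      then have "(i, j) \<in> {..p} \<times> {..p}" by auto
      then show ?thesis using B(3) by blast
    next
      case (L l i j)
      then have "(l, i, j) \<in> {..p} \<times> {..p} \<times> {..p}" by auto
      then show ?thesis using L(6) by (intro UnI2 image_eqI[of _ _ "(l, i, j)"]) auto
    qed
  qed
  then show ?thesis by (rule finite_subset) simp
qed

lemma G_hat_subset: "G \<subseteq> (syz_module :: (sym, 'k::field) vec set)"
proof
  fix g :: "(sym, 'k) vec" assume "g \<in> G"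
  then show "g \<in> syz_module"
  proof (cases rule: G_hat_cases)
    case (A i j)
    then show ?thesis using syzA_mem by auto
  next
    case (B i j)
    then have "i \<le> p" "j \<le> p" by auto
    then show ?thesis using B(3) syzB_mem by auto
  next
    case (L l i j)
    then show ?thesis using syzL_mem[OF L(1-3)] by simp
  qed
qed

lemma mon_dvd_lookup:
  assumes "mon_dvd (s, e) (t, f)"
  shows "e = f" and "Poly_Mapping.lookup s k \<le> Poly_Mapping.lookup t k"
  using assms by (auto simp: mon_dvd_def lookup_add)

lemma mon_dvdI:
  assumes "\<And>k. Poly_Mapping.lookup s k \<le> Poly_Mapping.lookup t k"
  shows "mon_dvd (s, e) (t, e)"
proof -
  have "t = (t - s) + s"
    using assms by (intro poly_mapping_eqI) (simp add: lookup_add lookup_minus)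
  then show ?thesis by (auto simp: mon_dvd_def)
qed

text \<open>The symbol of the leading monomial separates the three families, and within one family
  all leading monomials have the same degree, so divisibility means equality.\<close>

lemma G_hat_minimal:
  assumes "g \<in> (G :: (sym, 'k::field) vec set)" "h \<in> G" "mon_dvd (lead_mon gtM g) (lead_mon gtM h)"
  shows "g = h"
  using assms(1)
proof (cases rule: G_hat_cases)
  case g: (A i j)
  show ?thesis
    using assms(2)
  proof (cases rule: G_hat_cases)
    case h: (A i' j')
    then show ?thesis
      using g mon_dvd_lookup(1)[OF assms(3)[unfolded g(4) h(4)]]
        mon_dvd_lookup(2)[OF assms(3)[unfolded g(4) h(4)], of i]
      by (auto simp: lookup_var split: if_splits)
  next
    case h: (B i' j')
    then show ?thesis using g mon_dvd_lookup(1)[OF assms(3)[unfolded g(4) h(4)]] by simp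
  next
    case h: (L l' i' j')
    then show ?thesis using g mon_dvd_lookup(1)[OF assms(3)[unfolded g(4) h(7)]] by simp
  qed
next
  case g: (B i j)
  show ?thesis
    using assms(2)
  proof (cases rule: G_hat_cases)
    case h: (A i' j')
    then show ?thesis using g mon_dvd_lookup(1)[OF assms(3)[unfolded g(4) h(4)]] by simp
  next
    case h: (B i' j')
    \<comment> \<open>Equal products of two variables leave the order of the pair open;
      \<open>syzB_commute\<close> absorbs this.\<close>
    have "i = i' \<and> j = j' \<or> i = j' \<and> j = i'"
      using mon_dvd_lookup(2)[OF assms(3)[unfolded g(4) h(4)], of i]
        mon_dvd_lookup(2)[OF assms(3)[unfolded g(4) h(4)], of j]
      by (auto simp: lookup_add lookup_var split: if_splits)
    then show ?thesis using g(3) h(3) syzB_commute[of p a d b i j, where 'a = 'k] by auto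
  next
    case h: (L l' i' j')
    then show ?thesis using g mon_dvd_lookup(1)[OF assms(3)[unfolded g(4) h(7)]] by simp
  qed
next
  case g: (L l i j)
  show ?thesis
    using assms(2)
  proof (cases rule: G_hat_cases)
    case h: (A i' j')
    then show ?thesis using g mon_dvd_lookup(1)[OF assms(3)[unfolded g(7) h(4)]] by simp
  next
    case h: (B i' j')
    then show ?thesis using g mon_dvd_lookup(1)[OF assms(3)[unfolded g(7) h(4)]] by simp
  next
    case h: (L l' i' j')
    then show ?thesis
      using g mon_dvd_lookup(1)[OF assms(3)[unfolded g(7) h(7)]]
        mon_dvd_lookup(2)[OF assms(3)[unfolded g(7) h(7)], of l]
      by (auto simp: lookup_var split: if_splits)
  qed
qed

section \<open>Standard monomials\<close>

definition std_mons :: "(mono \<times> sym) set" where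
  "std_mons = {u \<in> mons p syms. \<forall>w\<in>lead_set. \<not> mon_dvd w u}"

text \<open>So the standard multiples of such a \<open>Psi j\<close> are by powers of
  \<open>X 0\<close> alone.\<close>

lemma std_Psi:
  assumes "(t, Psi j) \<in> std_mons" "j < p - b" "1 \<le> i" "i \<le> p"
  shows "Poly_Mapping.lookup t i = 0"
proof (rule ccontr)
  assume "Poly_Mapping.lookup t i \<noteq> 0"
  then have "mon_dvd (var i, Psi j) (t, Psi j)" by (intro mon_dvdI) (auto simp: lookup_var)
  moreover have "(var i, Psi j) \<in> lead_set" using assms by (auto simp: lead_set_def)
  ultimately show False using assms(1) by (auto simp: std_mons_def)
qed

text \<open>Over the last \<open>Psi\<close>, powers of \<open>X 0\<close> and \<open>X p\<close>
  are free, but at most one further variable may occur, to the first power.\<close>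

lemma std_Psi_last:
  assumes "(t, Psi (p - b)) \<in> std_mons" "1 \<le> i" "i \<le> p - 1" "1 \<le> j" "j \<le> p - 1"
  shows "\<exists>k. Poly_Mapping.lookup t k < Poly_Mapping.lookup (var i + var j) k"
proof (rule ccontr)
  assume "\<nexists>k. Poly_Mapping.lookup t k < Poly_Mapping.lookup (var i + var j) k"
  then have "mon_dvd (var i + var j, Psi (p - b)) (t, Psi (p - b))" by (intro mon_dvdI) (simp add: not_less)
  moreover have "i \<in> {1..p - 1}" "j \<in> {1..p - 1}" using assms(2-5) by simp_all
  then have "(var i + var j, Psi (p - b)) \<in> lead_set" unfolding lead_set_def by blast
  ultimately show False using assms(1) by (auto simp: std_mons_def)
qed

text \<open>This leaves \<open>X 0\<close> and the variables from \<open>X j\<close> to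
  \<open>X p\<close> over \<open>Phi i j\<close>.\<close>

lemma std_Phi:
  assumes "(t, Phi i j) \<in> std_mons" "1 \<le> l" "l < j"
  shows "Poly_Mapping.lookup t l = 0"
proof (rule ccontr)
  assume "Poly_Mapping.lookup t l \<noteq> 0"
  then have "mon_dvd (var l, Phi i j) (t, Phi i j)" by (intro mon_dvdI) (auto simp: lookup_var)
  moreover have "(var l, Phi i j) \<in> lead_set"
    using assms by (auto simp: lead_set_def std_mons_def mons_def basis_syms_def)
  ultimately show False using assms(1) by (auto simp: std_mons_def)
qed

text \<open>The smaller symbol \<open>f\<close> puts variables into the common value that neither a
  standard \<open>t\<close> nor the symbol \<open>e\<close> can supply.\<close>

lemma std_varpi_neq:
  assumes u: "(t, e) \<in> std_mons" and w: "(s, f) \<in> std_mons" and gt: "gt_sym e f"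
  shows "varpi p a b (t, e) \<noteq> varpi p a b (s, f)"
proof
  assume eq: "varpi p a b (t, e) = varpi p a b (s, f)"
  have syms: "e \<in> syms" "f \<in> syms" using u w by (auto simp: std_mons_def mons_def)
  have lk: "Poly_Mapping.lookup t k + Poly_Mapping.lookup (varpi_sym p a b e) k =
      Poly_Mapping.lookup s k + Poly_Mapping.lookup (varpi_sym p a b f) k" for k
    using arg_cong[OF eq, of "\<lambda>x. Poly_Mapping.lookup x k"] by (simp add: varpi_def lookup_add)
  show False
  proof (cases e)
    case e: (Psi j)
    show False
    proof (cases f)
      case f: (Psi j')
      have j: "j < j'" "j' \<le> p - b" using gt syms by (auto simp: e f basis_syms_def)
      \<comment> \<open>\<open>X p ^ a\<close> occurs on both sides and cancels; the factor
        \<open>X (b + j')\<close> on the right then has no counterpart on the left, where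
        \<open>t\<close> is a power of \<open>X 0\<close>.\<close>
      have "1 \<le> b + j'" "b + j' \<le> p" using j b by auto
      then have "Poly_Mapping.lookup t (b + j') = 0"
        using std_Psi[of t j "b + j'"] u j e by auto
      then show False
        using lk[of "b + j'"] j(1)
        by (simp add: e f varpi_sym_Psi lookup_add lookup_var del: varpi_sym.simps)
    next
      case f: (Phi i k)
      have ik: "1 \<le> i" "i \<le> k" "k \<le> p - 1" "1 \<le> k" "i \<le> p - 1" "i < p" "k < p"
        using syms(2) p by (auto simp: f basis_syms_def)
      have j: "j \<le> p - b" using syms(1) by (auto simp: e basis_syms_def)
      \<comment> \<open>At variables below \<open>p\<close> the factor \<open>X p ^ a\<close> is
        invisible, and \<open>i\<close>, \<open>k\<close> are below \<open>p\<close>; so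
        \<open>X i * X k\<close> divides \<open>t * X (b + j)\<close>.\<close>
      have le: "Poly_Mapping.lookup (var i + var k) l \<le> Poly_Mapping.lookup t l + Poly_Mapping.lookup (var (b + j)) l"
        if "l < p" for l
        using lk[of l] that
        by (simp add: e f varpi_sym_Psi varpi_sym_Phi lookup_add lookup_single when_def del: varpi_sym.simps)
      show False
      proof (cases "j < p - b")
        case True
        \<comment> \<open>Both \<open>X i\<close> and \<open>X k\<close> would have to come from the
          single factor \<open>X (b + j)\<close>.\<close>
        then have "Poly_Mapping.lookup t i = 0" "Poly_Mapping.lookup t k = 0"
          using std_Psi[of t j] u e ik by auto
        then show False
          using le[of i] le[of k] ik by (auto simp: lookup_add lookup_var split: if_splits)
      next
        case False
        \<comment> \<open>Now \<open>X (b + j)\<close> is \<open>X p\<close>, so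
          \<open>X i * X k\<close> divides \<open>t\<close> itself, against standardness.\<close>
        then have jb: "j = p - b" using j by simp
        then have "\<exists>l. Poly_Mapping.lookup t l < Poly_Mapping.lookup (var i + var k) l"
          using std_Psi_last[of t i k] u e ik by auto
        then obtain l where l: "Poly_Mapping.lookup t l < Poly_Mapping.lookup (var i + var k) l" ..
        then have "l = i \<or> l = k" by (auto simp: lookup_add lookup_var split: if_splits)
        then have "l < p" using ik by auto
        then have "Poly_Mapping.lookup (var (b + j)) l = 0" using jb b by (simp add: lookup_var)
        then show False using le[OF \<open>l < p\<close>] l by simp
      qed
    qed
  next
    case e: (Phi i j)
    then obtain i' j' where f: "f = Phi i' j'" using gt by (cases f) auto
    have ij: "1 \<le> i'" "i' \<le> j'" "i \<le> j" using syms by (auto simp: e f basis_syms_def)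
    \<comment> \<open>In this range \<open>t\<close> has no variables, so there
      \<open>X i' * X j'\<close> is bounded by \<open>X i * X j\<close>, which contributes at most
      one \<open>X i\<close>.\<close>
    have le: "Poly_Mapping.lookup (var i' + var j') l \<le> Poly_Mapping.lookup (var i + var j) l" if "1 \<le> l" "l < j" for l
      using lk[of l] std_Phi[of t i j l] that u
      by (simp add: e f varpi_sym_Phi del: varpi_sym.simps)
    from gt consider "j' < j" | "j' = j" "i' < i" by (auto simp: e f)
    then show False
    proof cases
      case 1
      then show False
        using le[of i'] le[of j'] ij by (auto simp: lookup_add lookup_var split: if_splits)
    next
      case 2
      then show False
        using le[of i'] ij by (auto simp: lookup_add lookup_var split: if_splits)
    qed
  qed
qed

text \<open>Distinct symbols are comparable, so equal values force equal symbols, and over one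
  symbol \<open>varpi\<close> is a translation.\<close>

lemma inj_on_varpi_std: "inj_on (varpi p a b) std_mons"
proof (rule inj_onI)
  fix x y assume xy: "x \<in> std_mons" "y \<in> std_mons" "varpi p a b x = varpi p a b y"
  obtain t e s f where te: "x = (t, e)" "y = (s, f)" by (cases x; cases y)
  note u = xy(1)[unfolded te] and w = xy(2)[unfolded te] and eq = xy(3)[unfolded te]
  have "\<not> gt_sym e f" "\<not> gt_sym f e" using std_varpi_neq[OF u w] std_varpi_neq[OF w u] eq by auto
  then have "e = f" using gt_sym_total[of e f] by blast
  then show "x = y" using eq by (simp add: te varpi_def)
qed

text \<open>The greatest \<open>varpi\<close>-value of a monomial of \<open>v\<close> is attained only once and exceeds all second
  terms, so it survives in the image of \<open>v\<close>.\<close>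

lemma syzygy_standard_zero:
  fixes v :: "(sym, 'k::field) vec"
  assumes v: "v \<in> syz_module" and std: "monomials v \<subseteq> std_mons"
  shows "v = 0"
proof (rule ccontr)
  assume "v \<noteq> 0"
  then have ne: "monomials v \<noteq> {}" by (simp add: monomials_eq_empty_iff)
  \<comment> \<open>Strictness comes from \<open>inj_on_varpi_std\<close>: terms with equal
    \<open>varpi\<close> could cancel in the image.\<close>
  have "\<exists>u\<in>monomials v. \<forall>w\<in>monomials v. w \<noteq> u \<longrightarrow> gtR (varpi p a b u) (varpi p a b w)"
  proof (rule finite_has_greatest[OF finite_monomials ne, where gt = "\<lambda>x y. gtR (varpi p a b x) (varpi p a b y)"])
    show "gtR (varpi p a b x) (varpi p a b z)"
      if "gtR (varpi p a b x) (varpi p a b y)" "gtR (varpi p a b y) (varpi p a b z)" for x y z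
      using that by (rule gt_R_trans)
    fix x y assume xy: "x \<in> monomials v" "y \<in> monomials v" "x \<noteq> y"
    then have "x \<in> std_mons" "y \<in> std_mons" using std by auto
    moreover from this have "x \<in> mons p syms" "y \<in> mons p syms" by (auto simp: std_mons_def)
    moreover have "varpi p a b x \<noteq> varpi p a b y"
      using inj_onD[OF inj_on_varpi_std] calculation(1,2) xy(3) by blast
    ultimately show "gtR (varpi p a b x) (varpi p a b y) \<or> gtR (varpi p a b y) (varpi p a b x)"
      by (intro gt_R_total varpi_keys)
  qed
  then obtain u where u: "u \<in> monomials v"
    and max: "\<And>w. w \<in> monomials v \<Longrightarrow> w \<noteq> u \<Longrightarrow> gtR (varpi p a b u) (varpi p a b w)" by blast
  have tail: "gtR (varpi p a b u) (fst w + tail_mono p a d (snd w))" if w: "w \<in> monomials v" for w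
  proof -
    have "snd w \<in> syms" using w std by (auto simp: std_mons_def mons_def)
    from gt_R_add_left[OF tail_mono_order[OF this], of "fst w"]
    have "gtR (varpi p a b w) (fst w + tail_mono p a d (snd w))" by (simp add: varpi_def)
    then show ?thesis using max[OF w] gt_R_trans[of p m "varpi p a b u" "varpi p a b w"] by (cases "w = u") auto
  qed
  have summand: "Poly_Mapping.lookup (Poly_Mapping.single (fst w) (coef v w) * gen_poly p a d b (snd w)) (varpi p a b u) =
      (if w = u then coef v w else 0)" if w: "w \<in> monomials v" for w
  proof -
    have "fst w + tail_mono p a d (snd w) \<noteq> varpi p a b u"
      using tail[OF w] gt_R_irrefl by metis
    moreover have "fst w + varpi_sym p a b (snd w) = varpi p a b u \<longleftrightarrow> w = u"
      using max[OF w] gt_R_irrefl unfolding varpi_def by metis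
    ultimately show ?thesis
      by (simp add: gen_poly_eq right_diff_distrib mult_single lookup_minus lookup_single when_def)
  qed
  have "lin_ext (gen_poly p a d b) v = 0"
    using v by (simp add: first_syzygy_module_def syzygies_iff)
  then have "0 = (\<Sum>w\<in>monomials v. Poly_Mapping.lookup
      (Poly_Mapping.single (fst w) (coef v w) * gen_poly p a d b (snd w)) (varpi p a b u))"
    unfolding lin_ext_decomposition by (simp flip: lookup_sum)
  also have "\<dots> = (\<Sum>w\<in>monomials v. if w = u then coef v w else 0)"
    by (rule sum.cong) (simp_all add: summand)
  also have "\<dots> = coef v u"
    using u by (simp add: finite_monomials)
  finally show False using u by (simp add: monomials_iff_coef)
qed

lemma minimal_groebner_basis_G_hat:
  "minimal_groebner_basis p gtM (syz_module :: (sym, 'k::field) vec set) G"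
proof -
  have lc: "lead_coef gtM g = 1" if "g \<in> G" for g :: "(sym, 'k) vec"
    using that by (cases rule: G_hat_cases) auto
  have free: "syz_module \<subseteq> (free_module p syms :: (sym, 'k) vec set)"
    by (auto simp: first_syzygy_module_def syzygies_iff)
  have "groebner_basis p gtM (syz_module :: (sym, 'k) vec set) G"
  proof (rule groebner_basisI[OF _ free G_hat_subset lc finite_G_hat])
    show "is_submodule p (syz_module :: (sym, 'k) vec set)"
      unfolding first_syzygy_module_def by (rule syzygies_submodule)
  next
    fix v :: "(sym, 'k) vec"
    assume v: "v \<in> syz_module" and std: "\<forall>u\<in>monomials v. \<forall>g\<in>G. \<not> mon_dvd (lead_mon gtM (g :: (sym, 'k) vec)) u"
    have "v \<in> free_module p syms" using v free by (rule rev_subsetD)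
    then have "monomials v \<subseteq> mons p syms" by (simp add: free_module_iff)
    then have "monomials v \<subseteq> std_mons"
      using std by (auto simp: std_mons_def simp flip: lead_set_eq[where 'k = 'k])
    then show "v = 0" by (rule syzygy_standard_zero[OF v])
  qed
  then show ?thesis
    using lc G_hat_minimal unfolding minimal_groebner_basis_def by blast
qed

end

theorem theorem6p2:
  fixes p d a b :: nat and m :: "nat \<Rightarrow> nat"
  assumes "p \<ge> 2" and "d \<ge> 1"
    and "0 < m 0" and "strict_mono_on {0..p} m"
    and "\<forall>i\<in>{1..p}. m i = m 0 + i * d"
    and "m 0 = a * p + b" and "a \<ge> 1" and "b \<in> {1..p}"
    and "gcd (m 0) d = 1"
    and "minimal_generators (m ` {0..p})"
  shows "minimal_groebner_basis p (gt_M p a b m)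
           (first_syzygy_module p a d b :: (sym, 'k::field) vec set) (G_hat p a d b)"
proof -
  interpret syzygy_setting p d a b m
  proof
    show "m i = a * p + b + i * d" if "i \<le> p" for i
      using that assms(5,6) by (cases "i = 0") auto
  qed (use assms in auto)
  show ?thesis by (rule minimal_groebner_basis_G_hat)
qed

end
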